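(* Let $X$ be a Calabi--Yau manifold with nowhere-vanishing holomorphic volume form $\Omega$, and let $\widehat G$ be a finite $\mathbb Z_2$-graded group acting on $X$ so that even elements act holomorphically, odd elements act anti-holomorphically, and the action preserves the complex line spanned by $\Omega$. Let $a:\widehat G\to(\mathbb R/\mathbb Z)_\epsilon$ be its phase cocycle and $[\mu_{\mathbb R}]\in H^2(\widehat G;\mathbb Z_\epsilon)$ the associated class. Then $$[\mu_{\mathbb R}]=-\beta([a]),$$ where $\beta:H^1(\widehat G;(\mathbb R/\mathbb Z)_\epsilon)\to H^2(\widehat G;\mathbb Z_\epsilon)$ is the Bockstein (connecting) homomorphism of $0\to\mathbb Z_\epsilon\to\mathbb R_\epsilon\to(\mathbb R/\mathbb Z)_\epsilon\to0$. Moreover, the following are equivalent: (i) $[\mu_{\mathbb R}]=0$; (ii) the phase cocycle admits a coherent real lift; (iii) after multiplying $\Omega$ by a constant unit complex number one can arrange $g^*\Omega=\Omega$ for all even $g$ and $\sigma^*\Omega=\overline\Omega$ for all odd $\sigma$. When $[\mu_{\mathbb R}]=0$, the coherent real lifts of the phase cocycle form a torsor for $Z^1(\widehat G;\mathbb Z_\epsilon)$, and their equivalence classes form a torsor for $H^1(\widehat G;\mathbb Z_\epsilon)$.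
   Context: A finite $\mathbb Z_2$-graded group is a finite group $\widehat G$ with an exact sequence $1\to G\to\widehat G\xrightarrow{\epsilon}\mathbb Z_2\to1$; elements of $G$ are even, the others odd. Preserving the line spanned by $\Omega$ means there are phases $a_\gamma\in\mathbb R/\mathbb Z$ with $g^*\Omega=e^{2\pi i a_g}\Omega$ for $g\in G$ and $\sigma^*\Omega=e^{2\pi i a_\sigma}\overline\Omega$ for $\epsilon(\sigma)=1$. $\mathbb Z_\epsilon,\mathbb R_\epsilon,(\mathbb R/\mathbb Z)_\epsilon$ are the sign modules, with action $\gamma\cdot t=(-1)^{\epsilon(\gamma)}t$. The phases satisfy $a_{\gamma\delta}\equiv a_\gamma+(-1)^{\epsilon(\gamma)}a_\delta\pmod{\mathbb Z}$, i.e. $a$ is a 1-cocycle with values in $(\mathbb R/\mathbb Z)_\epsilon$ (the phase cocycle). Choose real lifts $\widetilde a_\gamma\in\mathbb R$ of $a_\gamma$ and set $\mu_{\mathbb R}(\gamma,\delta)=\widetilde a_{\gamma\delta}-\widetilde a_\gamma-(-1)^{\epsilon(\gamma)}\widetilde a_\delta\in\mathbb Z$. This is a twisted 2-cocycle whose class $[\mu_{\mathbb R}]\in H^2(\widehat G;\mathbb Z_\epsilon)$ does not depend on the lifts. Group cohomology uses the standard inhomogeneous differential; in degree one $(\delta f)(\gamma,\eta)=(-1)^{\epsilon(\gamma)}f(\eta)-f(\gamma\eta)+f(\gamma)$. A coherent real lift is a choice of real lifts $\widehat a_\gamma$ of $a_\gamma$ with $\widehat a_{\gamma\delta}=\widehat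 a_\gamma+(-1)^{\epsilon(\gamma)}\widehat a_\delta$ for all $\gamma,\delta$. Two coherent lifts are equivalent if they differ by an integral twisted coboundary, i.e. a coboundary of an integer-valued 0-cochain. $Z^1$ denotes twisted 1-cocycles. *)

theory Defs
  imports
    "HOL-Analysis.Analysis"
    "HOL-Algebra.Group_Action"
    "HOL-Algebra.Product_Groups"
    "HOL-Algebra.Elementary_Groups"
begin

section \<open>The group \<open>\<real>/\<int>\<close>\<close>

quotient_type rz = real / "\<lambda>x y::real. x - y \<in> \<int>"
proof (rule equivpI)
  show "reflp (\<lambda>x y::real. x - y \<in> \<int>)" by (simp add: reflp_def)
  show "symp (\<lambda>x y::real. x - y \<in> \<int>)"
    by (metis (mono_tags, lifting) Ints_minus minus_diff_eq sympI)
  show "transp (\<lambda>x y::real. x - y \<in> \<int>)"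
  proof (rule transpI)
    fix x y z :: real
    assume "x - y \<in> \<int>" "y - z \<in> \<int>"
    then have "(x - y) + (y - z) \<in> \<int>" by (rule Ints_add)
    then show "x - z \<in> \<int>" by simp
  qed
qed

instantiation rz :: ab_group_add
begin

lift_definition zero_rz :: rz is "0" .

lift_definition plus_rz :: "rz \<Rightarrow> rz \<Rightarrow> rz" is "(+)"
proof -
  fix a b c d :: real
  assume "a - b \<in> \<int>" "c - d \<in> \<int>"
  then have "(a - b) + (c - d) \<in> \<int>" by (rule Ints_add)
  then show "(a + c) - (b + d) \<in> \<int>" by (simp add: algebra_simps)
qed

lift_definition uminus_rz :: "rz \<Rightarrow> rz" is "uminus"
proof -
  fix a b :: real
  assume "a - b \<in> \<int>"
  then have "- (a - b) \<in> \<int>" by (rule Ints_minus)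
  then show "- a - - b \<in> \<int>" by simp
qed

lift_definition minus_rz :: "rz \<Rightarrow> rz \<Rightarrow> rz" is "(-)"
proof -
  fix a b c d :: real
  assume "a - b \<in> \<int>" "c - d \<in> \<int>"
  then have "(a - b) - (c - d) \<in> \<int>" by (rule Ints_diff)
  then show "(a - c) - (b - d) \<in> \<int>" by (simp add: algebra_simps)
qed

instance
  by (standard; transfer; simp)

end

lift_definition rz_of_real :: "real \<Rightarrow> rz" is "\<lambda>x. x" .

text \<open>The phase factor \<open>e\<^sup>2\<^sup>\<pi>\<^sup>i\<^sup>a\<close> for \<open>a \<in> \<real>/\<int>\<close>.\<close>

lift_definition rz_exp :: "rz \<Rightarrow> complex" is "\<lambda>x. exp (2 * of_real pi * \<i> * of_real x)"
proof -
  fix x y :: real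
  assume "x - y \<in> \<int>"
  then obtain k :: int where k: "x - y = of_int k" by (auto elim: Ints_cases)
  then have "x = y + of_int k" by simp
  then have "2 * of_real pi * \<i> * of_real x =
      2 * of_real pi * \<i> * of_real y + of_real (of_int (2 * k) * pi) * \<i>"
    by (simp add: algebra_simps)
  then show "exp (2 * of_real pi * \<i> * of_real x) = exp (2 * of_real pi * \<i> * of_real y)"
    unfolding exp_eq by blast
qed


section \<open>Low-degree group cohomology\<close>

text \<open>
  A module over the group \<open>G\<close> is given by an additive group type \<open>'m\<close> together with the action
  \<open>act\<close>.  Cochains are extensional functions, so that cochain groups are product groups.
\<close>

definition add_group :: "'m::ab_group_add monoid" where
  "add_group = \<lparr>carrier = UNIV, monoid.mult = (+), one = 0\<rparr>"

definition C1 :: "('g, 'b) monoid_scheme \<Rightarrow> ('g \<Rightarrow> 'm::ab_group_add) monoid" where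
  "C1 G = product_group (carrier G) (\<lambda>_. add_group)"

definition C2 :: "('g, 'b) monoid_scheme \<Rightarrow> ('g \<times> 'g \<Rightarrow> 'm::ab_group_add) monoid" where
  "C2 G = product_group (carrier G \<times> carrier G) (\<lambda>_. add_group)"

definition d0 :: "('g \<Rightarrow> 'm \<Rightarrow> 'm) \<Rightarrow> 'm::ab_group_add \<Rightarrow> 'g \<Rightarrow> 'm" where
  "d0 act m \<gamma> = act \<gamma> m - m"

definition d1 :: "('g, 'b) monoid_scheme \<Rightarrow> ('g \<Rightarrow> 'm \<Rightarrow> 'm) \<Rightarrow> ('g \<Rightarrow> 'm::ab_group_add) \<Rightarrow> 'g \<times> 'g \<Rightarrow> 'm" where
  "d1 G act f = (\<lambda>(\<gamma>, \<eta>). act \<gamma> (f \<eta>) - f (\<gamma> \<otimes>\<^bsub>G\<^esub> \<eta>) + f \<gamma>)"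

definition d2 :: "('g, 'b) monoid_scheme \<Rightarrow> ('g \<Rightarrow> 'm \<Rightarrow> 'm) \<Rightarrow> ('g \<times> 'g \<Rightarrow> 'm::ab_group_add) \<Rightarrow> 'g \<times> 'g \<times> 'g \<Rightarrow> 'm" where
  "d2 G act f = (\<lambda>(\<gamma>, \<eta>, \<theta>). act \<gamma> (f (\<eta>, \<theta>)) - f (\<gamma> \<otimes>\<^bsub>G\<^esub> \<eta>, \<theta>)
                   + f (\<gamma>, \<eta> \<otimes>\<^bsub>G\<^esub> \<theta>) - f (\<gamma>, \<eta>))"

definition Z1 :: "('g, 'b) monoid_scheme \<Rightarrow> ('g \<Rightarrow> 'm \<Rightarrow> 'm) \<Rightarrow> ('g \<Rightarrow> 'm::ab_group_add) monoid" where
  "Z1 G act = (C1 G)\<lparr>carrier :=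
     {f \<in> carrier (C1 G). \<forall>x \<in> carrier G \<times> carrier G. d1 G act f x = 0}\<rparr>"

definition B1 :: "('g, 'b) monoid_scheme \<Rightarrow> ('g \<Rightarrow> 'm \<Rightarrow> 'm) \<Rightarrow> ('g \<Rightarrow> 'm::ab_group_add) set" where
  "B1 G act = {restrict (d0 act m) (carrier G) |m. True}"

definition H1 :: "('g, 'b) monoid_scheme \<Rightarrow> ('g \<Rightarrow> 'm \<Rightarrow> 'm) \<Rightarrow> ('g \<Rightarrow> 'm::ab_group_add) set monoid" where
  "H1 G act = Z1 G act Mod B1 G act"

definition class1 :: "('g, 'b) monoid_scheme \<Rightarrow> ('g \<Rightarrow> 'm \<Rightarrow> 'm) \<Rightarrow> ('g \<Rightarrow> 'm::ab_group_add) \<Rightarrow> ('g \<Rightarrow> 'm) set" where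
  "class1 G act f = B1 G act #>\<^bsub>Z1 G act\<^esub> f"

definition Z2 :: "('g, 'b) monoid_scheme \<Rightarrow> ('g \<Rightarrow> 'm \<Rightarrow> 'm) \<Rightarrow> ('g \<times> 'g \<Rightarrow> 'm::ab_group_add) monoid" where
  "Z2 G act = (C2 G)\<lparr>carrier :=
     {f \<in> carrier (C2 G). \<forall>x \<in> carrier G \<times> carrier G \<times> carrier G. d2 G act f x = 0}\<rparr>"

definition B2 :: "('g, 'b) monoid_scheme \<Rightarrow> ('g \<Rightarrow> 'm \<Rightarrow> 'm) \<Rightarrow> ('g \<times> 'g \<Rightarrow> 'm::ab_group_add) set" where
  "B2 G act = {restrict (d1 G act f) (carrier G \<times> carrier G) |f. f \<in> carrier (C1 G)}"

definition H2 :: "('g, 'b) monoid_scheme \<Rightarrow> ('g \<Rightarrow> 'm \<Rightarrow> 'm) \<Rightarrow> ('g \<times> 'g \<Rightarrow> 'm::ab_group_add) set monoid" where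
  "H2 G act = Z2 G act Mod B2 G act"

definition class2 :: "('g, 'b) monoid_scheme \<Rightarrow> ('g \<Rightarrow> 'm \<Rightarrow> 'm) \<Rightarrow> ('g \<times> 'g \<Rightarrow> 'm::ab_group_add) \<Rightarrow> ('g \<times> 'g \<Rightarrow> 'm) set" where
  "class2 G act f = B2 G act #>\<^bsub>Z2 G act\<^esub> f"

text \<open>
  The connecting map \<open>H\<^sup>1(G; C) \<rightarrow> H\<^sup>2(G; A)\<close> of a short exact sequence of modules
  \<open>0 \<rightarrow> A \<rightarrow> B \<rightarrow> C \<rightarrow> 0\<close> with maps \<open>i\<close> and \<open>p\<close>: lift a representing cocycle
  along \<open>p\<close>, apply the differential of \<open>B\<close>, and pull back along \<open>i\<close>.  The resulting class does
  not depend on the choices, so the description is definite.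
\<close>

definition connecting ::
  "('g, 'b) monoid_scheme \<Rightarrow> ('g \<Rightarrow> 'x \<Rightarrow> 'x) \<Rightarrow> ('g \<Rightarrow> 'y \<Rightarrow> 'y) \<Rightarrow>
   ('x::ab_group_add \<Rightarrow> 'y::ab_group_add) \<Rightarrow> ('y \<Rightarrow> 'z::ab_group_add) \<Rightarrow>
   ('g \<Rightarrow> 'z) set \<Rightarrow> ('g \<times> 'g \<Rightarrow> 'x) set" where
  "connecting G actA actB i p \<alpha> = (THE \<kappa>. \<exists>c\<in>\<alpha>. \<exists>f\<in>carrier (C1 G). \<exists>z\<in>carrier (C2 G).
      (\<forall>\<gamma>\<in>carrier G. p (f \<gamma>) = c \<gamma>) \<and>
      (\<forall>x\<in>carrier G \<times> carrier G. i (z x) = d1 G actB f x) \<and>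
      \<kappa> = class2 G actA z)"


section \<open>Graded groups, sign modules and the Bockstein\<close>

text \<open>
  In the exact sequence \<open>1 \<rightarrow> G \<rightarrow> Ghat \<rightarrow> \<int>\<^sub>2 \<rightarrow> 1\<close> the group \<open>G\<close> is the kernel of the grading
  \<open>\<epsilon>\<close>, so the data are a finite group and an epimorphism to \<open>\<int>\<^sub>2 = {0, 1}\<close>.
\<close>

definition graded_group :: "('g, 'b) monoid_scheme \<Rightarrow> ('g \<Rightarrow> int) \<Rightarrow> bool" where
  "graded_group G \<epsilon> \<longleftrightarrow> group G \<and> finite (carrier G) \<and> \<epsilon> \<in> epi G (integer_mod_group 2)"

definition sgn_act :: "('g \<Rightarrow> int) \<Rightarrow> 'g \<Rightarrow> 'm::ab_group_add \<Rightarrow> 'm" where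
  "sgn_act \<epsilon> \<gamma> t = (if \<epsilon> \<gamma> = 0 then t else - t)"

definition bockstein ::
  "('g, 'b) monoid_scheme \<Rightarrow> ('g \<Rightarrow> int) \<Rightarrow> ('g \<Rightarrow> rz) set \<Rightarrow> ('g \<times> 'g \<Rightarrow> int) set" where
  "bockstein G \<epsilon> = connecting G (sgn_act \<epsilon>) (sgn_act \<epsilon>) real_of_int rz_of_real"


section \<open>Torsors\<close>

definition torsor :: "('h, 'b) monoid_scheme \<Rightarrow> 'e set \<Rightarrow> ('h \<Rightarrow> 'e \<Rightarrow> 'e) \<Rightarrow> bool" where
  "torsor H E \<phi> \<longleftrightarrow> E \<noteq> {} \<and> group_action H E \<phi> \<and>
     (\<forall>x\<in>E. \<forall>y\<in>E. \<exists>!h. h \<in> carrier H \<and> \<phi> h x = y)"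


section \<open>Real lifts\<close>

definition real_lift :: "('g, 'b) monoid_scheme \<Rightarrow> ('g \<Rightarrow> rz) \<Rightarrow> ('g \<Rightarrow> real) \<Rightarrow> bool" where
  "real_lift G a b \<longleftrightarrow> b \<in> extensional (carrier G) \<and> (\<forall>\<gamma>\<in>carrier G. rz_of_real (b \<gamma>) = a \<gamma>)"

text \<open>
  For a lift \<open>b\<close> of a cocycle the argument of the floor function is an integer; the floor only
  serves to read it off as an element of type \<^typ>\<open>int\<close>.
\<close>

definition mu_R :: "('g, 'b) monoid_scheme \<Rightarrow> ('g \<Rightarrow> int) \<Rightarrow> ('g \<Rightarrow> real) \<Rightarrow> 'g \<times> 'g \<Rightarrow> int" where
  "mu_R G \<epsilon> b = (\<lambda>(\<gamma>, \<delta>) \<in> carrier G \<times> carrier G.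
     \<lfloor>b (\<gamma> \<otimes>\<^bsub>G\<^esub> \<delta>) - b \<gamma> - sgn_act \<epsilon> \<gamma> (b \<delta>)\<rfloor>)"

definition mu_class ::
  "('g, 'b) monoid_scheme \<Rightarrow> ('g \<Rightarrow> int) \<Rightarrow> ('g \<Rightarrow> real) \<Rightarrow> ('g \<times> 'g \<Rightarrow> int) set" where
  "mu_class G \<epsilon> b = class2 G (sgn_act \<epsilon>) (mu_R G \<epsilon> b)"

definition coherent_lifts ::
  "('g, 'b) monoid_scheme \<Rightarrow> ('g \<Rightarrow> int) \<Rightarrow> ('g \<Rightarrow> rz) \<Rightarrow> ('g \<Rightarrow> real) set" where
  "coherent_lifts G \<epsilon> a = {b. real_lift G a b \<and>
     (\<forall>\<gamma>\<in>carrier G. \<forall>\<delta>\<in>carrier G. b (\<gamma> \<otimes>\<^bsub>G\<^esub> \<delta>) = b \<gamma> + sgn_act \<epsilon> \<gamma> (b \<delta>))}"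

definition lift_equiv ::
  "('g, 'b) monoid_scheme \<Rightarrow> ('g \<Rightarrow> int) \<Rightarrow> ('g \<Rightarrow> rz) \<Rightarrow> (('g \<Rightarrow> real) \<times> ('g \<Rightarrow> real)) set" where
  "lift_equiv G \<epsilon> a = {(b, b'). b \<in> coherent_lifts G \<epsilon> a \<and> b' \<in> coherent_lifts G \<epsilon> a \<and>
     (\<exists>m::int. \<forall>\<gamma>\<in>carrier G. b' \<gamma> - b \<gamma> = of_int (d0 (sgn_act \<epsilon>) m \<gamma>))}"

definition shift :: "('g, 'b) monoid_scheme \<Rightarrow> ('g \<Rightarrow> int) \<Rightarrow> ('g \<Rightarrow> real) \<Rightarrow> 'g \<Rightarrow> real" where
  "shift G z b = (\<lambda>\<gamma>\<in>carrier G. b \<gamma> + of_int (z \<gamma>))"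

text \<open>
  The actions by translation, on coherent lifts and on their equivalence classes.  They are
  restricted to the set acted upon because \<^const>\<open>group_action\<close> uses extensional bijections.
\<close>

definition lift_action ::
  "('g, 'b) monoid_scheme \<Rightarrow> ('g \<Rightarrow> int) \<Rightarrow> ('g \<Rightarrow> rz) \<Rightarrow> ('g \<Rightarrow> int) \<Rightarrow> ('g \<Rightarrow> real) \<Rightarrow> 'g \<Rightarrow> real" where
  "lift_action G \<epsilon> a z = (\<lambda>b \<in> coherent_lifts G \<epsilon> a. shift G z b)"

definition lift_class_action ::
  "('g, 'b) monoid_scheme \<Rightarrow> ('g \<Rightarrow> int) \<Rightarrow> ('g \<Rightarrow> rz) \<Rightarrow>
   ('g \<Rightarrow> int) set \<Rightarrow> ('g \<Rightarrow> real) set \<Rightarrow> ('g \<Rightarrow> real) set" where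
  "lift_class_action G \<epsilon> a \<alpha> = (\<lambda>B \<in> coherent_lifts G \<epsilon> a // lift_equiv G \<epsilon> a.
     {shift G z b |z b. z \<in> \<alpha> \<and> b \<in> B})"


section \<open>Complex manifolds\<close>

text \<open>
  A chart is a pair of its domain and its coordinate map; the map is only relevant on the domain.
\<close>

type_synonym ('a, 'n) chart = "'a set \<times> ('a \<Rightarrow> complex ^ 'n)"

abbreviation chart_inv :: "('a, 'n) chart \<Rightarrow> complex ^ 'n \<Rightarrow> 'a" where
  "chart_inv c \<equiv> inv_into (fst c) (snd c)"

definition local_rep ::
  "('a, 'n) chart \<Rightarrow> ('a, 'n) chart \<Rightarrow> ('a \<Rightarrow> 'a) \<Rightarrow> complex ^ 'n \<Rightarrow> complex ^ 'n" where
  "local_rep c d g = snd d \<circ> g \<circ> chart_inv c"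

definition local_rep_dom ::
  "('a, 'n) chart \<Rightarrow> ('a, 'n) chart \<Rightarrow> ('a \<Rightarrow> 'a) \<Rightarrow> (complex ^ 'n) set" where
  "local_rep_dom c d g = snd c ` {p \<in> fst c. g p \<in> fst d}"

definition holomorphic_vec_on ::
  "(complex ^ 'n::finite \<Rightarrow> complex ^ 'm::finite) \<Rightarrow> (complex ^ 'n) set \<Rightarrow> bool" where
  "holomorphic_vec_on f S \<longleftrightarrow>
     (\<forall>z\<in>S. \<exists>D. (f has_derivative D) (at z) \<and> (\<forall>k v. D (k *s v) = k *s D v))"

definition antiholomorphic_vec_on ::
  "(complex ^ 'n::finite \<Rightarrow> complex ^ 'm::finite) \<Rightarrow> (complex ^ 'n) set \<Rightarrow> bool" where
  "antiholomorphic_vec_on f S \<longleftrightarrow>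
     (\<forall>z\<in>S. \<exists>D. (f has_derivative D) (at z) \<and> (\<forall>k v. D (k *s v) = cnj k *s D v))"

definition holomorphic_fun_on ::
  "(complex ^ 'n::finite \<Rightarrow> complex) \<Rightarrow> (complex ^ 'n) set \<Rightarrow> bool" where
  "holomorphic_fun_on f S \<longleftrightarrow>
     (\<forall>z\<in>S. \<exists>D. (f has_derivative D) (at z) \<and> (\<forall>k v. D (k *s v) = k * D v))"

definition complex_manifold :: "'a topology \<Rightarrow> ('a, 'n::finite) chart set \<Rightarrow> bool" where
  "complex_manifold X A \<longleftrightarrow>
     Hausdorff_space X \<and> second_countable X \<and>
     (\<Union>c\<in>A. fst c) = topspace X \<and>
     (\<forall>c\<in>A. openin X (fst c) \<and> open (snd c ` fst c) \<and>
        homeomorphic_map (subtopology X (fst c)) (top_of_set (snd c ` fst c)) (snd c)) \<and>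
     (\<forall>c\<in>A. \<forall>d\<in>A. holomorphic_vec_on (local_rep c d id) (local_rep_dom c d id))"

definition holomorphic_map ::
  "'a topology \<Rightarrow> ('a, 'n::finite) chart set \<Rightarrow> ('a \<Rightarrow> 'a) \<Rightarrow> bool" where
  "holomorphic_map X A g \<longleftrightarrow> continuous_map X X g \<and>
     (\<forall>c\<in>A. \<forall>d\<in>A. holomorphic_vec_on (local_rep c d g) (local_rep_dom c d g))"

definition antiholomorphic_map ::
  "'a topology \<Rightarrow> ('a, 'n::finite) chart set \<Rightarrow> ('a \<Rightarrow> 'a) \<Rightarrow> bool" where
  "antiholomorphic_map X A g \<longleftrightarrow> continuous_map X X g \<and>
     (\<forall>c\<in>A. \<forall>d\<in>A. antiholomorphic_vec_on (local_rep c d g) (local_rep_dom c d g))"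


section \<open>Tangent vectors and forms\<close>

text \<open>
  A tangent vector at \<open>p\<close> is a family of coordinate vectors, one for each chart around \<open>p\<close>,
  that transform into each other by the differentials of the coordinate changes.  The
  entries for all other charts are \<open>0\<close>.
\<close>

type_synonym ('a, 'n) tangent = "('a, 'n) chart \<Rightarrow> complex ^ 'n"

definition tangent_space :: "('a, 'n::finite) chart set \<Rightarrow> 'a \<Rightarrow> ('a, 'n) tangent set" where
  "tangent_space A p = {v.
     (\<forall>c\<in>A. \<forall>d\<in>A. p \<in> fst c \<longrightarrow> p \<in> fst d \<longrightarrow>
        v d = frechet_derivative (local_rep c d id) (at (snd c p)) (v c)) \<and>
     (\<forall>c. c \<notin> A \<or> p \<notin> fst c \<longrightarrow> v c = 0)}"

text \<open>
  The differential of \<open>g\<close> at \<open>p\<close>.  By the transformation law of tangent vectors it does not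
  depend on the chart around \<open>p\<close> in which it is computed.
\<close>

definition pushforward ::
  "('a, 'n::finite) chart set \<Rightarrow> ('a \<Rightarrow> 'a) \<Rightarrow> 'a \<Rightarrow> ('a, 'n) tangent \<Rightarrow> ('a, 'n) tangent" where
  "pushforward A g p v = (let c = (SOME c. c \<in> A \<and> p \<in> fst c) in
     (\<lambda>d. if d \<in> A \<and> g p \<in> fst d
          then frechet_derivative (local_rep c d g) (at (snd c p)) (v c) else 0))"

text \<open>
  Complex-valued forms of degree \<open>n\<close> (the complex dimension) are functions of a point and an
  \<open>n\<close>-tuple of tangent vectors at this point; their values elsewhere are irrelevant, hence the
  notion of equality below.
\<close>

type_synonym ('a, 'n) nform = "'a \<Rightarrow> ('n \<Rightarrow> ('a, 'n) tangent) \<Rightarrow> complex"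

definition form_eq ::
  "('a, 'n::finite) chart set \<Rightarrow> ('a, 'n) nform \<Rightarrow> ('a, 'n) nform \<Rightarrow> bool" where
  "form_eq A \<omega> \<omega>' \<longleftrightarrow>
     (\<forall>p\<in>(\<Union>c\<in>A. fst c). \<forall>v. (\<forall>i. v i \<in> tangent_space A p) \<longrightarrow> \<omega> p v = \<omega>' p v)"

definition pullback ::
  "('a, 'n::finite) chart set \<Rightarrow> ('a \<Rightarrow> 'a) \<Rightarrow> ('a, 'n) nform \<Rightarrow> ('a, 'n) nform" where
  "pullback A g \<omega> = (\<lambda>p v. \<omega> (g p) (\<lambda>i. pushforward A g p (v i)))"

definition form_scale :: "complex \<Rightarrow> ('a, 'n) nform \<Rightarrow> ('a, 'n) nform" where
  "form_scale k \<omega> = (\<lambda>p v. k * \<omega> p v)"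

definition form_cnj :: "('a, 'n) nform \<Rightarrow> ('a, 'n) nform" where
  "form_cnj \<omega> = (\<lambda>p v. cnj (\<omega> p v))"

text \<open>
  In each chart the form is \<open>f dz\<^sub>1 \<and> \<dots> \<and> dz\<^sub>n\<close> with \<open>f\<close> holomorphic; the value of
  \<open>dz\<^sub>1 \<and> \<dots> \<and> dz\<^sub>n\<close> on \<open>n\<close> vectors is the determinant of their coordinate matrix.
\<close>

definition holomorphic_volume_form ::
  "('a, 'n::finite) chart set \<Rightarrow> ('a, 'n) nform \<Rightarrow> bool" where
  "holomorphic_volume_form A \<Omega> \<longleftrightarrow> (\<forall>c\<in>A. \<exists>f. holomorphic_fun_on f (snd c ` fst c) \<and>
     (\<forall>p\<in>fst c. \<forall>v. (\<forall>i. v i \<in> tangent_space A p) \<longrightarrow>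
        \<Omega> p v = f (snd c p) * det (\<chi> i. v i c)))"

definition nowhere_vanishing ::
  "('a, 'n::finite) chart set \<Rightarrow> ('a, 'n) nform \<Rightarrow> bool" where
  "nowhere_vanishing A \<Omega> \<longleftrightarrow>
     (\<forall>p\<in>(\<Union>c\<in>A. fst c). \<exists>v. (\<forall>i. v i \<in> tangent_space A p) \<and> \<Omega> p v \<noteq> 0)"


section \<open>Calabi--Yau manifolds\<close>

primrec Ck_on ::
  "nat \<Rightarrow> ('v::real_normed_vector \<Rightarrow> 'w::real_normed_vector) \<Rightarrow> 'v set \<Rightarrow> bool" where
  "Ck_on 0 f S \<longleftrightarrow> continuous_on S f"
| "Ck_on (Suc k) f S \<longleftrightarrow> (\<forall>x\<in>S. f differentiable (at x)) \<and>
     (\<forall>v. Ck_on k (\<lambda>x. frechet_derivative f (at x) v) S)"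

text \<open>
  A Kaehler metric is a smooth Riemannian metric \<open>h\<close> with \<open>h(iv, iw) = h(v, w)\<close> whose
  fundamental form \<open>F(v, w) = h(iv, w)\<close> is closed.  In a chart, \<open>h\<close> is given by the bilinear
  forms \<open>H z\<close>, and the last condition is \<open>dF(u, v, w) = 0\<close> for constant vector fields.
\<close>

definition kaehler_metric ::
  "('a, 'n::finite) chart set \<Rightarrow> ('a \<Rightarrow> ('a, 'n) tangent \<Rightarrow> ('a, 'n) tangent \<Rightarrow> real) \<Rightarrow> bool" where
  "kaehler_metric A h \<longleftrightarrow> (\<forall>c\<in>A. \<exists>H :: complex ^ 'n \<Rightarrow> complex ^ 'n \<Rightarrow> complex ^ 'n \<Rightarrow> real.
     (\<forall>p\<in>fst c. \<forall>v\<in>tangent_space A p. \<forall>w\<in>tangent_space A p. h p v w = H (snd c p) (v c) (w c)) \<and>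
     (\<forall>v w. \<forall>k. Ck_on k (\<lambda>z. H z v w) (snd c ` fst c)) \<and>
     (\<forall>z\<in>snd c ` fst c. bilinear (H z) \<and>
        (\<forall>v w. H z v w = H z w v) \<and> (\<forall>v. v \<noteq> 0 \<longrightarrow> H z v v > 0) \<and>
        (\<forall>v w. H z (\<i> *s v) (\<i> *s w) = H z v w) \<and>
        (\<forall>u v w. frechet_derivative (\<lambda>y. H y (\<i> *s v) w) (at z) u
               - frechet_derivative (\<lambda>y. H y (\<i> *s u) w) (at z) v
               + frechet_derivative (\<lambda>y. H y (\<i> *s u) v) (at z) w = 0)))"

text \<open>Calabi--Yau manifolds are not required to be compact or connected.\<close>

definition calabi_yau ::
  "'a topology \<Rightarrow> ('a, 'n::finite) chart set \<Rightarrow> ('a, 'n) nform \<Rightarrow> bool" where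
  "calabi_yau X A \<Omega> \<longleftrightarrow> topspace X \<noteq> {} \<and> complex_manifold X A \<and> (\<exists>h. kaehler_metric A h) \<and>
     holomorphic_volume_form A \<Omega> \<and> nowhere_vanishing A \<Omega>"


section \<open>Graded actions and their phases\<close>

definition graded_holomorphic_action ::
  "'a topology \<Rightarrow> ('a, 'n::finite) chart set \<Rightarrow> ('g, 'b) monoid_scheme \<Rightarrow> ('g \<Rightarrow> int) \<Rightarrow>
   ('g \<Rightarrow> 'a \<Rightarrow> 'a) \<Rightarrow> bool" where
  "graded_holomorphic_action X A G \<epsilon> \<rho> \<longleftrightarrow> group_action G (topspace X) \<rho> \<and>
     (\<forall>\<gamma>\<in>carrier G. (\<epsilon> \<gamma> = 0 \<longrightarrow> holomorphic_map X A (\<rho> \<gamma>)) \<and>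
                      (\<epsilon> \<gamma> = 1 \<longrightarrow> antiholomorphic_map X A (\<rho> \<gamma>)))"

text \<open>The action preserves the line spanned by \<open>\<Omega>\<close> with the phases \<open>a\<close>.\<close>

definition phase_cocycle ::
  "('a, 'n::finite) chart set \<Rightarrow> ('g, 'b) monoid_scheme \<Rightarrow> ('g \<Rightarrow> int) \<Rightarrow>
   ('g \<Rightarrow> 'a \<Rightarrow> 'a) \<Rightarrow> ('a, 'n) nform \<Rightarrow> ('g \<Rightarrow> rz) \<Rightarrow> bool" where
  "phase_cocycle A G \<epsilon> \<rho> \<Omega> a \<longleftrightarrow> a \<in> extensional (carrier G) \<and>
     (\<forall>\<gamma>\<in>carrier G.
        (\<epsilon> \<gamma> = 0 \<longrightarrow> form_eq A (pullback A (\<rho> \<gamma>) \<Omega>) (form_scale (rz_exp (a \<gamma>)) \<Omega>)) \<and>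
        (\<epsilon> \<gamma> = 1 \<longrightarrow> form_eq A (pullback A (\<rho> \<gamma>) \<Omega>) (form_scale (rz_exp (a \<gamma>)) (form_cnj \<Omega>))))"

definition real_normalized ::
  "('a, 'n::finite) chart set \<Rightarrow> ('g, 'b) monoid_scheme \<Rightarrow> ('g \<Rightarrow> int) \<Rightarrow>
   ('g \<Rightarrow> 'a \<Rightarrow> 'a) \<Rightarrow> ('a, 'n) nform \<Rightarrow> bool" where
  "real_normalized A G \<epsilon> \<rho> \<Omega> \<longleftrightarrow>
     (\<forall>\<gamma>\<in>carrier G.
        (\<epsilon> \<gamma> = 0 \<longrightarrow> form_eq A (pullback A (\<rho> \<gamma>) \<Omega>) \<Omega>) \<and>
        (\<epsilon> \<gamma> = 1 \<longrightarrow> form_eq A (pullback A (\<rho> \<gamma>) \<Omega>) (form_cnj \<Omega>)))"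

end

theory Submission
  imports Defs
begin

text \<open>
  The geometry enters only through the cocycle identity
  \<open>a (\<gamma> \<delta>) = a \<gamma> + \<epsilon>(\<gamma>) a \<delta>\<close> (\<open>phase_cocycle_mult\<close>), where \<open>\<epsilon>(\<gamma>)\<close> stands for the sign by which
  \<open>\<gamma>\<close> acts.  Pullback is functorial by the chain rule, so \<open>(\<gamma> \<delta>)\<^sup>* \<Omega> = \<delta>\<^sup>* (\<gamma>\<^sup>* \<Omega>)\<close>, and an odd
  \<open>\<gamma>\<close> conjugates the phase of \<open>\<delta>\<close> when it is moved past the conjugation in
  \<open>\<gamma>\<^sup>* \<Omega> = e\<^sup>2\<^sup>\<pi>\<^sup>i\<^sup>a cnj \<Omega>\<close>; evaluating at one place where \<open>\<Omega>\<close> does not vanish gives the identity.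

  The rest is group cohomology.  A real lift \<open>b\<close> of \<open>a\<close> is a cochain whose differential is
  integral, and that differential represents the Bockstein of \<open>[a]\<close>.  Since \<open>\<mu>\<close> is by
  definition minus the differential of \<open>b\<close>, its class is minus the Bockstein
  (\<open>connecting_class1\<close>, \<open>mu_class_eq_inv_bockstein\<close>).  Any two lifts differ by an integral
  cochain \<open>f\<close>, and \<open>b + f\<close> is coherent exactly if \<open>\<mu>\<close> is the differential of \<open>f\<close>; hence coherent
  lifts exist if and only if the class vanishes (\<open>mu_class_trivial_iff\<close>).

  A coherent lift is a real cocycle.  The group is finite, so averaging over it makes the cocycle a
  coboundary \<open>\<gamma> \<mapsto> \<epsilon>(\<gamma>) t - t\<close>, and \<open>e\<^sup>2\<^sup>\<pi>\<^sup>i\<^sup>t\<close> is precisely the constant by which \<open>\<Omega>\<close> has to be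
  multiplied; conversely a normalizing constant provides such a \<open>t\<close>
  (\<open>coherent_lift_iff_normalizable\<close>).  Finally, the difference of two coherent lifts is an integral
  cocycle, which is the first torsor, and the second torsor is its quotient by the coboundaries
  (\<open>torsor_quotient\<close>).
\<close>

section \<open>Real numbers modulo integers and phase factors\<close>

lemma rz_of_real_add: "rz_of_real (x + y) = rz_of_real x + rz_of_real y"
  by transfer simp

lemma rz_of_real_diff: "rz_of_real (x - y) = rz_of_real x - rz_of_real y"
  by transfer simp

lemma rz_of_real_minus: "rz_of_real (- x) = - rz_of_real x"
  by transfer simp

lemma rz_of_real_eq_0_iff: "rz_of_real x = 0 \<longleftrightarrow> x \<in> \<int>"
  by transfer simp

lemma rz_of_real_eq_iff: "rz_of_real x = rz_of_real y \<longleftrightarrow> x - y \<in> \<int>"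
  by transfer simp

lemma surj_rz_of_real: "\<exists>x. rz_of_real x = r"
  by transfer (metis Ints_0 cancel_comm_monoid_add_class.diff_cancel)

lemma rz_exp_of_real: "rz_exp (rz_of_real x) = cis (2 * pi * x)"
  by transfer (simp add: cis_conv_exp algebra_simps)

lemma rz_exp_add: "rz_exp (r + s) = rz_exp r * rz_exp s"
  by transfer (simp add: algebra_simps exp_add)

lemma cnj_rz_exp: "cnj (rz_exp r) = rz_exp (- r)"
  by transfer (simp add: exp_cnj)

lemma inj_rz_exp: "rz_exp r = rz_exp s \<longleftrightarrow> r = s"
proof -
  obtain x y where xy: "r = rz_of_real x" "s = rz_of_real y"
    using surj_rz_of_real by metis
  have "x - y \<in> \<int>" if eq: "rz_exp r = rz_exp s"
  proof -
    have "exp (\<i> * complex_of_real (2 * pi * x)) = exp (\<i> * complex_of_real (2 * pi * y))"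
      using eq by (simp add: xy rz_exp_of_real cis_conv_exp)
    then obtain n :: int where
      "\<i> * complex_of_real (2 * pi * x) = \<i> * complex_of_real (2 * pi * y) + (of_int (2 * n) * pi) * \<i>"
      unfolding exp_eq by blast
    then have "Im (\<i> * complex_of_real (2 * pi * x))
        = Im (\<i> * complex_of_real (2 * pi * y) + (of_int (2 * n) * pi) * \<i>)"
      by (rule arg_cong)
    then have "pi * x = pi * (y + of_int n)" by (simp add: algebra_simps)
    then have "x - y = of_int n" by simp
    then show ?thesis by simp
  qed
  then show ?thesis by (metis xy rz_of_real_eq_iff)
qed

lemma unit_complex_eq_rz_exp:
  assumes "cmod k = 1"
  obtains u where "k = rz_exp (rz_of_real u)"
proof -
  have "k = cis (Arg k)" using rcis_cmod_Arg[of k] assms by (simp add: rcis_def)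
  then have "k = rz_exp (rz_of_real (Arg k / (2 * pi)))" by (simp add: rz_exp_of_real)
  then show ?thesis using that by blast
qed


section \<open>Torsors and their quotients\<close>

lemma group_actionI:
  assumes "group H"
    and closed: "\<And>h x. h \<in> carrier H \<Longrightarrow> x \<in> E \<Longrightarrow> \<phi> h x \<in> E"
    and ext: "\<And>h. h \<in> carrier H \<Longrightarrow> \<phi> h \<in> extensional E"
    and one: "\<And>x. x \<in> E \<Longrightarrow> \<phi> \<one>\<^bsub>H\<^esub> x = x"
    and mult: "\<And>g h x. g \<in> carrier H \<Longrightarrow> h \<in> carrier H \<Longrightarrow> x \<in> E \<Longrightarrow>
      \<phi> (g \<otimes>\<^bsub>H\<^esub> h) x = \<phi> g (\<phi> h x)"
  shows "group_action H E \<phi>"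
proof -
  interpret group H by fact
  have Bij: "\<phi> h \<in> Bij E" if h: "h \<in> carrier H" for h
  proof -
    have "bij_betw (\<phi> h) E E"
    proof (rule bij_betwI[where g = "\<phi> (inv\<^bsub>H\<^esub> h)"])
      show "\<phi> (inv\<^bsub>H\<^esub> h) (\<phi> h x) = x" if "x \<in> E" for x
        using mult[of "inv\<^bsub>H\<^esub> h" h x] h that one by simp
      show "\<phi> h (\<phi> (inv\<^bsub>H\<^esub> h) y) = y" if "y \<in> E" for y
        using mult[of h "inv\<^bsub>H\<^esub> h" y] h that one by simp
    qed (use closed h in auto)
    then show ?thesis using ext[OF h] by (simp add: Bij_def)
  qed
  have "\<phi> (g \<otimes>\<^bsub>H\<^esub> h) = compose E (\<phi> g) (\<phi> h)" if "g \<in> carrier H" "h \<in> carrier H" for g h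
    using that by (intro extensionalityI[of _ E]) (auto simp: ext compose_eq mult)
  then have "\<phi> \<in> hom H (BijGroup E)"
    using Bij by (auto simp: hom_def BijGroup_def)
  then show ?thesis
    by (simp add: group_action_def group_hom_def group_hom_axioms_def group_BijGroup is_group)
qed

text \<open>
  Dividing a torsor by the orbits of a normal subgroup gives a torsor of the quotient group:
  normality lets a coset \<open>N h\<close> map the orbit \<open>N x\<close> onto the orbit \<open>N (h x)\<close>, and if cosets of \<open>h\<close>
  and \<open>h'\<close> both take \<open>N x\<close> to \<open>N y\<close>, then simple transitivity upstairs puts \<open>h\<close> into \<open>N h'\<close>.
\<close>

lemma torsor_quotient:
  assumes tor: "torsor H E \<phi>" and N: "N \<lhd> H"
    and R: "R = {(x, y). x \<in> E \<and> y \<in> E \<and> (\<exists>n\<in>N. y = \<phi> n x)}"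
  shows "torsor (H Mod N) (E // R) (\<lambda>\<alpha>. \<lambda>B\<in>E // R. {\<phi> h x |h x. h \<in> \<alpha> \<and> x \<in> B})"
    (is "torsor _ _ ?\<psi>")
proof -
  interpret group_action H E \<phi> using tor by (simp add: torsor_def)
  interpret normal N H by fact
  have closed: "\<phi> h x \<in> E" if "h \<in> carrier H" "x \<in> E" for h x
    using element_image that by blast
  have one: "\<phi> \<one>\<^bsub>H\<^esub> x = x" if "x \<in> E" for x
    using that id_eq_one by (metis restrict_apply')
  have ex1: "\<exists>!h. h \<in> carrier H \<and> \<phi> h x = y" if "x \<in> E" "y \<in> E" for x y
    using tor that by (simp add: torsor_def)
  have cls: "R `` {x} = {\<phi> n x |n. n \<in> N}" if "x \<in> E" for x
    using that closed by (auto simp: R)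
  have act: "{\<phi> k y |k y. k \<in> N #>\<^bsub>H\<^esub> h \<and> y \<in> R `` {x}} = R `` {\<phi> h x}"
    if h: "h \<in> carrier H" and x: "x \<in> E" for h x
  proof (intro equalityI subsetI)
    fix w assume "w \<in> {\<phi> k y |k y. k \<in> N #>\<^bsub>H\<^esub> h \<and> y \<in> R `` {x}}"
    then obtain n n' where n: "n \<in> N" "n' \<in> N" and w: "w = \<phi> (n \<otimes>\<^bsub>H\<^esub> h) (\<phi> n' x)"
      unfolding cls[OF x] by (auto simp: r_coset_def)
    \<comment> \<open>Normality moves \<open>n'\<close> to the left of \<open>h\<close>.\<close>
    have "h \<otimes>\<^bsub>H\<^esub> n' \<in> N #>\<^bsub>H\<^esub> h"
      using coset_eq h n(2) by (auto simp: l_coset_def)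
    then obtain n'' where n'': "n'' \<in> N" "h \<otimes>\<^bsub>H\<^esub> n' = n'' \<otimes>\<^bsub>H\<^esub> h"
      by (auto simp: r_coset_def)
    have "w = \<phi> ((n \<otimes>\<^bsub>H\<^esub> h) \<otimes>\<^bsub>H\<^esub> n') x"
      using w n h x by (simp add: composition_rule)
    also have "(n \<otimes>\<^bsub>H\<^esub> h) \<otimes>\<^bsub>H\<^esub> n' = (n \<otimes>\<^bsub>H\<^esub> n'') \<otimes>\<^bsub>H\<^esub> h"
      using n n'' h by (simp add: m_assoc)
    also have "\<phi> \<dots> x = \<phi> (n \<otimes>\<^bsub>H\<^esub> n'') (\<phi> h x)"
      using n n'' h x by (simp add: composition_rule)
    finally show "w \<in> R `` {\<phi> h x}"
      using n n'' by (auto simp: cls closed h x)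
  next
    fix w assume "w \<in> R `` {\<phi> h x}"
    then obtain n where n: "n \<in> N" and w: "w = \<phi> n (\<phi> h x)"
      by (auto simp: cls closed h x)
    then have "w = \<phi> (n \<otimes>\<^bsub>H\<^esub> h) x" using h x by (simp add: composition_rule)
    moreover have "n \<otimes>\<^bsub>H\<^esub> h \<in> N #>\<^bsub>H\<^esub> h" using n by (auto simp: r_coset_def)
    moreover have "x \<in> R `` {x}" using one[OF x] by (auto simp: cls[OF x] intro: exI[of _ "\<one>\<^bsub>H\<^esub>"])
    ultimately show "w \<in> {\<phi> k y |k y. k \<in> N #>\<^bsub>H\<^esub> h \<and> y \<in> R `` {x}}" by blast
  qed
  have quot: "B \<in> E // R \<longleftrightarrow> (\<exists>x\<in>E. B = R `` {x})" for B
    by (auto simp: quotient_def)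
  have psi: "?\<psi> (N #>\<^bsub>H\<^esub> h) (R `` {x}) = R `` {\<phi> h x}" if "h \<in> carrier H" "x \<in> E" for h x
    using act[OF that] that by (subst restrict_apply') (auto simp: quot)
  have car: "\<alpha> \<in> carrier (H Mod N) \<longleftrightarrow> (\<exists>h\<in>carrier H. \<alpha> = N #>\<^bsub>H\<^esub> h)" for \<alpha>
    by (auto simp: carrier_FactGroup)
  have "group_action (H Mod N) (E // R) ?\<psi>"
  proof (rule group_actionI)
    show "group (H Mod N)" by (rule factorgroup_is_group)
    show "?\<psi> \<alpha> B \<in> E // R" if "\<alpha> \<in> carrier (H Mod N)" "B \<in> E // R" for \<alpha> B
      using that closed by (force simp: car quot psi simp del: restrict_apply)
    show "?\<psi> \<alpha> \<in> extensional (E // R)" for \<alpha> by simp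
    show "?\<psi> \<one>\<^bsub>H Mod N\<^esub> B = B" if "B \<in> E // R" for B
    proof -
      obtain x where x: "x \<in> E" "B = R `` {x}" using \<open>B \<in> E // R\<close> by (auto simp: quot)
      have "N #>\<^bsub>H\<^esub> \<one>\<^bsub>H\<^esub> = N" by (rule rcos_const) (auto intro: is_group)
      then show ?thesis using psi[of "\<one>\<^bsub>H\<^esub>" x] x one by (simp del: restrict_apply)
    qed
    show "?\<psi> (\<alpha> \<otimes>\<^bsub>H Mod N\<^esub> \<beta>) B = ?\<psi> \<alpha> (?\<psi> \<beta> B)"
      if \<alpha>\<beta>: "\<alpha> \<in> carrier (H Mod N)" "\<beta> \<in> carrier (H Mod N)" and B: "B \<in> E // R" for \<alpha> \<beta> B
    proof -
      obtain g h x where gh: "g \<in> carrier H" "h \<in> carrier H" "x \<in> E"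
        and eq: "\<alpha> = N #>\<^bsub>H\<^esub> g" "\<beta> = N #>\<^bsub>H\<^esub> h" "B = R `` {x}"
        using \<alpha>\<beta> B by (auto simp: car quot)
      have "\<alpha> \<otimes>\<^bsub>H Mod N\<^esub> \<beta> = N #>\<^bsub>H\<^esub> (g \<otimes>\<^bsub>H\<^esub> h)"
        using gh eq by (simp add: rcos_sum)
      then show ?thesis
        using gh by (simp add: eq psi closed composition_rule del: restrict_apply mult_FactGroup)
    qed
  qed
  moreover have "E // R \<noteq> {}" using tor by (auto simp: torsor_def quotient_def)
  moreover have "\<exists>!\<alpha>. \<alpha> \<in> carrier (H Mod N) \<and> ?\<psi> \<alpha> B = C" if B: "B \<in> E // R" and C: "C \<in> E // R" for B C
  proof -
    obtain x y where xy: "x \<in> E" "y \<in> E" and eq: "B = R `` {x}" "C = R `` {y}"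
      using B C by (auto simp: quot)
    obtain h where h: "h \<in> carrier H" "\<phi> h x = y" using ex1[OF xy] by blast
    show ?thesis
    proof (rule ex1I[of _ "N #>\<^bsub>H\<^esub> h"])
      show "N #>\<^bsub>H\<^esub> h \<in> carrier (H Mod N) \<and> ?\<psi> (N #>\<^bsub>H\<^esub> h) B = C"
        using h xy psi by (auto simp: car eq simp del: restrict_apply)
    next
      fix \<alpha> assume \<alpha>: "\<alpha> \<in> carrier (H Mod N) \<and> ?\<psi> \<alpha> B = C"
      then obtain h' where h': "h' \<in> carrier H" "\<alpha> = N #>\<^bsub>H\<^esub> h'" by (auto simp: car)
      have "R `` {\<phi> h' x} = R `` {y}" using \<alpha> h' psi[OF h'(1) xy(1)] by (simp add: eq del: restrict_apply)
      moreover have "y \<in> R `` {y}"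
        using one[OF xy(2)] by (auto simp: cls[OF xy(2)] intro: exI[of _ "\<one>\<^bsub>H\<^esub>"])
      ultimately obtain n where n: "n \<in> N" "y = \<phi> n (\<phi> h' x)"
        by (auto simp: cls closed h' xy)
      then have "\<phi> (n \<otimes>\<^bsub>H\<^esub> h') x = y" using h' xy by (simp add: composition_rule)
      then have "h = n \<otimes>\<^bsub>H\<^esub> h'" using ex1[OF xy] h h' n by (metis m_closed mem_carrier)
      then have "h \<in> N #>\<^bsub>H\<^esub> h'" using n by (auto simp: r_coset_def)
      then show "\<alpha> = N #>\<^bsub>H\<^esub> h"
        using repr_independence h' subgroup_axioms by simp
    qed
  qed
  ultimately show ?thesis by (simp add: torsor_def del: restrict_apply)
qed


section \<open>Cocycles, coboundaries and the connecting map\<close>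

lemma carrier_C1: "carrier (C1 G) = extensional (carrier G)"
  by (auto simp: C1_def add_group_def PiE_def)

lemma carrier_C2: "carrier (C2 G) = extensional (carrier G \<times> carrier G)"
  by (auto simp: C2_def add_group_def PiE_def)

lemma mult_Z1: "f \<otimes>\<^bsub>Z1 G act\<^esub> g = (\<lambda>\<gamma>\<in>carrier G. f \<gamma> + g \<gamma>)"
  by (simp add: Z1_def C1_def add_group_def)

lemma one_Z1: "\<one>\<^bsub>Z1 G act\<^esub> = (\<lambda>\<gamma>\<in>carrier G. 0)"
  by (simp add: Z1_def C1_def add_group_def)

lemma mem_Z1:
  fixes f :: "'g \<Rightarrow> 'm::ab_group_add"
  shows "f \<in> carrier (Z1 G act) \<longleftrightarrow> f \<in> extensional (carrier G) \<and>
    (\<forall>\<gamma>\<in>carrier G. \<forall>\<eta>\<in>carrier G. f (\<gamma> \<otimes>\<^bsub>G\<^esub> \<eta>) = f \<gamma> + act \<gamma> (f \<eta>))"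
proof -
  have "x - y + z = 0 \<longleftrightarrow> y = z + x" for x y z :: "'m::ab_group_add"
    by (metis add.commute diff_add_eq eq_iff_diff_eq_0)
  then show ?thesis by (simp add: Z1_def carrier_C1 d1_def)
qed

lemma mult_Z2: "f \<otimes>\<^bsub>Z2 G act\<^esub> g = (\<lambda>x\<in>carrier G \<times> carrier G. f x + g x)"
  by (simp add: Z2_def C2_def add_group_def)

lemma one_Z2: "\<one>\<^bsub>Z2 G act\<^esub> = (\<lambda>x\<in>carrier G \<times> carrier G. 0)"
  by (simp add: Z2_def C2_def add_group_def)

lemma mem_Z2: "f \<in> carrier (Z2 G act) \<longleftrightarrow> f \<in> extensional (carrier G \<times> carrier G) \<and>
    (\<forall>\<gamma>\<in>carrier G. \<forall>\<eta>\<in>carrier G. \<forall>\<theta>\<in>carrier G. d2 G act f (\<gamma>, \<eta>, \<theta>) = 0)"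
  by (simp add: Z2_def carrier_C2)

locale group_module = group G for G (structure) +
  fixes act :: "'a \<Rightarrow> 'm::ab_group_add \<Rightarrow> 'm"
  assumes act_add: "\<gamma> \<in> carrier G \<Longrightarrow> act \<gamma> (x + y) = act \<gamma> x + act \<gamma> y"
    and act_mult: "\<gamma> \<in> carrier G \<Longrightarrow> \<eta> \<in> carrier G \<Longrightarrow> act (\<gamma> \<otimes> \<eta>) x = act \<gamma> (act \<eta> x)"
    and act_one: "act \<one> x = x"
begin

lemma act_zero: "\<gamma> \<in> carrier G \<Longrightarrow> act \<gamma> 0 = 0"
  by (metis act_add add_cancel_left_left add_0)

lemma act_minus: "\<gamma> \<in> carrier G \<Longrightarrow> act \<gamma> (- x) = - act \<gamma> x"
  by (metis act_add act_zero ab_left_minus add_eq_0_iff minus_unique)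

lemma act_diff: "\<gamma> \<in> carrier G \<Longrightarrow> act \<gamma> (x - y) = act \<gamma> x - act \<gamma> y"
  by (metis act_add act_minus diff_conv_add_uminus)

lemmas act_simps = act_zero act_add act_minus act_diff act_mult

lemma d1_d0: "\<gamma> \<in> carrier G \<Longrightarrow> \<eta> \<in> carrier G \<Longrightarrow> d1 G act (d0 act m) (\<gamma>, \<eta>) = 0"
  by (simp add: d1_def d0_def act_simps)

lemma d2_d1:
  "\<gamma> \<in> carrier G \<Longrightarrow> \<eta> \<in> carrier G \<Longrightarrow> \<theta> \<in> carrier G \<Longrightarrow> d2 G act (d1 G act f) (\<gamma>, \<eta>, \<theta>) = 0"
  by (simp add: d2_def d1_def act_simps m_assoc)

lemma comm_group_Z1: "comm_group (Z1 G act)"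
proof (rule comm_groupI)
  fix f assume f: "f \<in> carrier (Z1 G act)"
  then show "\<exists>g\<in>carrier (Z1 G act). g \<otimes>\<^bsub>Z1 G act\<^esub> f = \<one>\<^bsub>Z1 G act\<^esub>"
    by (intro bexI[of _ "\<lambda>\<gamma>\<in>carrier G. - f \<gamma>"])
       (auto simp: mem_Z1 mult_Z1 one_Z1 act_simps fun_eq_iff)
  show "\<one>\<^bsub>Z1 G act\<^esub> \<otimes>\<^bsub>Z1 G act\<^esub> f = f"
    using f by (auto simp: mem_Z1 mult_Z1 one_Z1 intro!: extensionalityI[of _ "carrier G"])
qed (auto simp: mem_Z1 mult_Z1 one_Z1 act_simps algebra_simps fun_eq_iff)

lemma comm_group_Z2: "comm_group (Z2 G act)"
proof (rule comm_groupI)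
  fix f assume f: "f \<in> carrier (Z2 G act)"
  then show "\<exists>g\<in>carrier (Z2 G act). g \<otimes>\<^bsub>Z2 G act\<^esub> f = \<one>\<^bsub>Z2 G act\<^esub>"
    by (intro bexI[of _ "\<lambda>x\<in>carrier G \<times> carrier G. - f x"])
       (auto simp: mem_Z2 mult_Z2 one_Z2 d2_def act_simps algebra_simps fun_eq_iff)
  show "\<one>\<^bsub>Z2 G act\<^esub> \<otimes>\<^bsub>Z2 G act\<^esub> f = f"
    using f by (auto simp: mem_Z2 mult_Z2 one_Z2 intro!: extensionalityI[of _ "carrier G \<times> carrier G"])
next
  fix f g assume "f \<in> carrier (Z2 G act)" "g \<in> carrier (Z2 G act)"
  then show "f \<otimes>\<^bsub>Z2 G act\<^esub> g \<in> carrier (Z2 G act)"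
    by (auto simp: mem_Z2 mult_Z2 d2_def act_simps algebra_simps)
qed (auto simp: mem_Z2 mult_Z2 one_Z2 d2_def act_simps algebra_simps fun_eq_iff)

lemma B1_normal: "B1 G act \<lhd> Z1 G act"
proof -
  interpret Z: comm_group "Z1 G act" by (rule comm_group_Z1)
  have sub: "B1 G act \<subseteq> carrier (Z1 G act)"
    by (auto simp: B1_def mem_Z1 d0_def act_simps)
  have "subgroup (B1 G act) (Z1 G act)"
  proof (rule Z.subgroupI[OF sub])
    show "B1 G act \<noteq> {}" by (auto simp: B1_def)
  next
    fix f assume f: "f \<in> B1 G act"
    then obtain m where m: "f = restrict (d0 act m) (carrier G)" by (auto simp: B1_def)
    let ?g = "restrict (d0 act (- m)) (carrier G)"
    have g: "?g \<in> B1 G act" by (auto simp: B1_def)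
    have "?g \<otimes>\<^bsub>Z1 G act\<^esub> f = \<one>\<^bsub>Z1 G act\<^esub>"
      by (auto simp: m mult_Z1 one_Z1 d0_def act_simps fun_eq_iff)
    then have "inv\<^bsub>Z1 G act\<^esub> f = ?g"
      using f g sub by (intro Z.inv_equality) auto
    then show "inv\<^bsub>Z1 G act\<^esub> f \<in> B1 G act" using g by simp
  next
    fix f g assume "f \<in> B1 G act" "g \<in> B1 G act"
    then obtain m n where "f = restrict (d0 act m) (carrier G)" "g = restrict (d0 act n) (carrier G)"
      by (auto simp: B1_def)
    then have "f \<otimes>\<^bsub>Z1 G act\<^esub> g = restrict (d0 act (m + n)) (carrier G)"
      by (auto simp: mult_Z1 d0_def act_simps fun_eq_iff)
    then show "f \<otimes>\<^bsub>Z1 G act\<^esub> g \<in> B1 G act" by (auto simp: B1_def)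
  qed
  then show ?thesis by (simp add: Z.normal_iff_subgroup)
qed

lemma B2_normal: "B2 G act \<lhd> Z2 G act"
proof -
  interpret Z: comm_group "Z2 G act" by (rule comm_group_Z2)
  have d2_restrict: "d2 G act (restrict f (carrier G \<times> carrier G)) (\<gamma>, \<eta>, \<theta>) = d2 G act f (\<gamma>, \<eta>, \<theta>)"
    if "\<gamma> \<in> carrier G" "\<eta> \<in> carrier G" "\<theta> \<in> carrier G" for f \<gamma> \<eta> \<theta>
    using that by (simp add: d2_def)
  have sub: "B2 G act \<subseteq> carrier (Z2 G act)"
    by (auto simp: B2_def mem_Z2 d2_restrict d2_d1)
  have "subgroup (B2 G act) (Z2 G act)"
  proof (rule Z.subgroupI[OF sub])
    show "B2 G act \<noteq> {}" by (auto simp: B2_def carrier_C1 intro: restrict_extensional)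
  next
    fix f assume f: "f \<in> B2 G act"
    then obtain k where k: "f = restrict (d1 G act k) (carrier G \<times> carrier G)"
      by (auto simp: B2_def)
    let ?g = "restrict (d1 G act (\<lambda>\<gamma>\<in>carrier G. - k \<gamma>)) (carrier G \<times> carrier G)"
    have g: "?g \<in> B2 G act" by (auto simp: B2_def carrier_C1)
    have "?g \<otimes>\<^bsub>Z2 G act\<^esub> f = \<one>\<^bsub>Z2 G act\<^esub>"
      by (auto simp: k mult_Z2 one_Z2 d1_def act_simps fun_eq_iff)
    then have "inv\<^bsub>Z2 G act\<^esub> f = ?g"
      using f g sub by (intro Z.inv_equality) auto
    then show "inv\<^bsub>Z2 G act\<^esub> f \<in> B2 G act" using g by simp
  next
    fix f g assume "f \<in> B2 G act" "g \<in> B2 G act"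
    then obtain k l where "f = restrict (d1 G act k) (carrier G \<times> carrier G)"
        "g = restrict (d1 G act l) (carrier G \<times> carrier G)"
      by (auto simp: B2_def)
    then have "f \<otimes>\<^bsub>Z2 G act\<^esub> g
        = restrict (d1 G act (\<lambda>\<gamma>\<in>carrier G. k \<gamma> + l \<gamma>)) (carrier G \<times> carrier G)"
      by (auto simp: mult_Z2 d1_def act_simps fun_eq_iff)
    then show "f \<otimes>\<^bsub>Z2 G act\<^esub> g \<in> B2 G act" by (auto simp: B2_def carrier_C1)
  qed
  then show ?thesis by (simp add: Z.normal_iff_subgroup)
qed

text \<open>
  A difference of coboundary form may be witnessed by any function \<open>k\<close>: its values off the group do
  not enter the differential, so it can be replaced by an extensional cochain.
\<close>

lemma class2_eqI:
  assumes "z \<in> carrier (Z2 G act)" "z' \<in> extensional (carrier G \<times> carrier G)"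
    and k: "\<And>x. x \<in> carrier G \<times> carrier G \<Longrightarrow> z' x = d1 G act k x + z x"
  shows "class2 G act z' = class2 G act z"
proof -
  interpret normal "B2 G act" "Z2 G act" by (rule B2_normal)
  let ?k = "restrict k (carrier G)"
  have "z' = restrict (d1 G act ?k) (carrier G \<times> carrier G) \<otimes>\<^bsub>Z2 G act\<^esub> z"
    by (rule extensionalityI[of _ "carrier G \<times> carrier G"])
       (use assms(2) in \<open>auto simp: mult_Z2 k d1_def\<close>)
  moreover have "restrict (d1 G act ?k) (carrier G \<times> carrier G) \<in> B2 G act"
    by (auto simp: B2_def carrier_C1)
  ultimately have "z' \<in> B2 G act #>\<^bsub>Z2 G act\<^esub> z" by (auto simp: r_coset_def)
  then show ?thesis
    using assms(1) repr_independence[OF _ _ subgroup_axioms, of z' z] by (simp add: class2_def)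
qed

lemma class2_eq_one_iff:
  assumes "z \<in> carrier (Z2 G act)"
  shows "class2 G act z = \<one>\<^bsub>H2 G act\<^esub> \<longleftrightarrow>
    (\<exists>f. \<forall>x\<in>carrier G \<times> carrier G. z x = d1 G act f x)"
proof -
  interpret normal "B2 G act" "Z2 G act" by (rule B2_normal)
  have "class2 G act z = \<one>\<^bsub>H2 G act\<^esub> \<longleftrightarrow> z \<in> B2 G act"
    unfolding class2_def H2_def one_FactGroup
    using assms coset_join1[OF _ _ subgroup_axioms] rcos_const[OF is_group] by blast
  also have "\<dots> \<longleftrightarrow> (\<exists>f. \<forall>x\<in>carrier G \<times> carrier G. z x = d1 G act f x)"
  proof
    assume "\<exists>f. \<forall>x\<in>carrier G \<times> carrier G. z x = d1 G act f x"
    then obtain f where f: "\<forall>x\<in>carrier G \<times> carrier G. z x = d1 G act f x" by blast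
    have "z = restrict (d1 G act (restrict f (carrier G))) (carrier G \<times> carrier G)"
      by (rule extensionalityI[of _ "carrier G \<times> carrier G"])
         (use assms f in \<open>auto simp: mem_Z2 d1_def\<close>)
    then show "z \<in> B2 G act" by (auto simp: B2_def carrier_C1)
  qed (auto simp: B2_def)
  finally show ?thesis .
qed

lemma class2_inv:
  assumes "z \<in> carrier (Z2 G act)"
  shows "class2 G act (\<lambda>x\<in>carrier G \<times> carrier G. - z x) = inv\<^bsub>H2 G act\<^esub> class2 G act z"
proof -
  interpret Z: comm_group "Z2 G act" by (rule comm_group_Z2)
  interpret normal "B2 G act" "Z2 G act" by (rule B2_normal)
  interpret h: group_hom "Z2 G act" "H2 G act" "\<lambda>z. B2 G act #>\<^bsub>Z2 G act\<^esub> z"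
    by (simp add: group_hom_def group_hom_axioms_def H2_def factorgroup_is_group r_coset_hom_Mod is_group)
  have "inv\<^bsub>Z2 G act\<^esub> z = (\<lambda>x\<in>carrier G \<times> carrier G. - z x)"
    by (rule Z.inv_equality)
       (use assms in \<open>auto simp: mem_Z2 mult_Z2 one_Z2 d2_def act_simps algebra_simps fun_eq_iff\<close>)
  then show ?thesis using h.hom_inv[OF assms] by (simp add: class2_def)
qed

end

text \<open>
  The choices in the connecting map do not matter.  Another representative differs from \<open>c\<close> by the
  coboundary of some \<open>m\<close>; lifting \<open>m\<close> to \<open>m'\<close> and subtracting its coboundary, which is closed, leaves
  two lifts whose difference vanishes under \<open>p\<close>.  By exactness this difference comes from a cochain
  \<open>k\<close> with values in the kernel module, and the two resulting cocycles differ by the differential of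
  \<open>k\<close>.  Injectivity of \<open>i\<close> carries identities from the middle module, such as closedness, back.
\<close>

lemma connecting_class1:
  fixes actA :: "'g \<Rightarrow> 'x::ab_group_add \<Rightarrow> 'x" and actB :: "'g \<Rightarrow> 'y::ab_group_add \<Rightarrow> 'y"
    and actC :: "'g \<Rightarrow> 'z::ab_group_add \<Rightarrow> 'z"
  assumes A: "group_module G actA" and B: "group_module G actB"
    and i_add: "\<And>x y. i (x + y) = i x + i y" and i_inj: "inj i"
    and i_act: "\<And>\<gamma> x. \<gamma> \<in> carrier G \<Longrightarrow> i (actA \<gamma> x) = actB \<gamma> (i x)"
    and p_add: "\<And>x y. p (x + y) = p x + p y" and p_surj: "surj p"
    and p_act: "\<And>\<gamma> y. \<gamma> \<in> carrier G \<Longrightarrow> p (actB \<gamma> y) = actC \<gamma> (p y)"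
    and exact: "\<And>y. p y = 0 \<longleftrightarrow> y \<in> range i"
    and f: "f \<in> carrier (C1 G)" and z: "z \<in> carrier (C2 G)"
    and c: "c \<in> extensional (carrier G)"
    and pf: "\<And>\<gamma>. \<gamma> \<in> carrier G \<Longrightarrow> p (f \<gamma>) = c \<gamma>"
    and iz: "\<And>x. x \<in> carrier G \<times> carrier G \<Longrightarrow> i (z x) = d1 G actB f x"
  shows "z \<in> carrier (Z2 G actA)"
    and "connecting G actA actB i p (class1 G actC c) = class2 G actA z"
proof -
  interpret A: group_module G actA by fact
  interpret B: group_module G actB by fact
  have i_diff: "i (x - y) = i x - i y" for x y
    by (metis i_add add_diff_cancel diff_add_cancel)
  have p_diff: "p (x - y) = p x - p y" for x y
    by (metis p_add add_diff_cancel diff_add_cancel)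
  have p0: "p 0 = 0" and i0: "i 0 = 0" using p_diff[of 0 0] i_diff[of 0 0] by simp_all
  show Z: "z \<in> carrier (Z2 G actA)"
    unfolding mem_Z2
  proof (intro conjI ballI)
    fix \<gamma> \<eta> \<theta> assume *: "\<gamma> \<in> carrier G" "\<eta> \<in> carrier G" "\<theta> \<in> carrier G"
    have "i (d2 G actA z (\<gamma>, \<eta>, \<theta>)) = d2 G actB (d1 G actB f) (\<gamma>, \<eta>, \<theta>)"
      using * by (simp add: d2_def i_add i_diff i_act iz)
    then have "i (d2 G actA z (\<gamma>, \<eta>, \<theta>)) = i 0" using * by (simp add: B.d2_d1 i0)
    then show "d2 G actA z (\<gamma>, \<eta>, \<theta>) = 0" using i_inj by (simp add: inj_eq)
  qed (use z in \<open>simp add: carrier_C2\<close>)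
  show "connecting G actA actB i p (class1 G actC c) = class2 G actA z"
    unfolding connecting_def
  proof (rule the_equality)
    \<comment> \<open>The cocycle \<open>c\<close> lies in its own class because the coboundary of \<open>0\<close> vanishes.\<close>
    have "restrict (d0 actC 0) (carrier G) \<in> B1 G actC" by (auto simp: B1_def)
    moreover have "actC \<gamma> 0 = 0" if "\<gamma> \<in> carrier G" for \<gamma>
      using p_act[OF that, of 0] B.act_zero[OF that] by (simp add: p0)
    then have "c = restrict (d0 actC 0) (carrier G) \<otimes>\<^bsub>Z1 G actC\<^esub> c"
      by (intro extensionalityI[OF c]) (auto simp: mult_Z1 d0_def)
    ultimately have "c \<in> class1 G actC c" unfolding class1_def r_coset_def by blast
    then show "\<exists>c\<in>class1 G actC c. \<exists>f\<in>carrier (C1 G). \<exists>z'\<in>carrier (C2 G).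
        (\<forall>\<gamma>\<in>carrier G. p (f \<gamma>) = c \<gamma>) \<and> (\<forall>x\<in>carrier G \<times> carrier G. i (z' x) = d1 G actB f x) \<and>
        class2 G actA z = class2 G actA z'"
      using f z pf iz by blast
  next
    fix \<kappa> assume "\<exists>c\<in>class1 G actC c. \<exists>f\<in>carrier (C1 G). \<exists>z\<in>carrier (C2 G).
        (\<forall>\<gamma>\<in>carrier G. p (f \<gamma>) = c \<gamma>) \<and> (\<forall>x\<in>carrier G \<times> carrier G. i (z x) = d1 G actB f x) \<and>
        \<kappa> = class2 G actA z"
    then obtain c' f' z' where c': "c' \<in> class1 G actC c" and z': "z' \<in> carrier (C2 G)"
      and pf': "\<And>\<gamma>. \<gamma> \<in> carrier G \<Longrightarrow> p (f' \<gamma>) = c' \<gamma>"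
      and iz': "\<And>x. x \<in> carrier G \<times> carrier G \<Longrightarrow> i (z' x) = d1 G actB f' x"
      and \<kappa>: "\<kappa> = class2 G actA z'"
      by blast
    obtain m where m: "\<And>\<gamma>. \<gamma> \<in> carrier G \<Longrightarrow> c' \<gamma> = d0 actC m \<gamma> + c \<gamma>"
      using c' by (auto simp: class1_def r_coset_def B1_def mult_Z1)
    obtain m' where m': "p m' = m" using p_surj by (metis surjD)
    have "\<exists>k. f' \<gamma> - f \<gamma> - d0 actB m' \<gamma> = i k" if \<gamma>: "\<gamma> \<in> carrier G" for \<gamma>
    proof -
      have "p (f' \<gamma> - f \<gamma> - d0 actB m' \<gamma>) = 0"
        using \<gamma> by (simp add: p_diff pf pf' m d0_def p_act m')
      then show ?thesis by (auto simp: exact)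
    qed
    then obtain k where k: "\<And>\<gamma>. \<gamma> \<in> carrier G \<Longrightarrow> f' \<gamma> - f \<gamma> - d0 actB m' \<gamma> = i (k \<gamma>)"
      by metis
    have "z' x = d1 G actA k x + z x" if x: "x \<in> carrier G \<times> carrier G" for x
    proof -
      obtain \<gamma> \<eta> where \<gamma>\<eta>: "x = (\<gamma>, \<eta>)" "\<gamma> \<in> carrier G" "\<eta> \<in> carrier G" using x by auto
      have "i (d1 G actA k x) = d1 G actB (\<lambda>\<gamma>. f' \<gamma> - f \<gamma> - d0 actB m' \<gamma>) x"
        using \<gamma>\<eta> by (simp add: d1_def i_add i_diff i_act k)
      also have "\<dots> = d1 G actB f' x - d1 G actB f x - d1 G actB (d0 actB m') x"
        using \<gamma>\<eta> by (simp add: d1_def B.act_diff B.act_add algebra_simps)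
      also have "\<dots> = i (z' x) - i (z x)"
        using \<gamma>\<eta> by (simp add: B.d1_d0 iz iz')
      finally have "i (z' x) = i (d1 G actA k x + z x)" by (simp add: i_add)
      then show ?thesis using i_inj by (simp add: inj_eq)
    qed
    then show "\<kappa> = class2 G actA z"
      unfolding \<kappa> using Z z' by (intro A.class2_eqI[where k = k]) (simp_all add: carrier_C2)
  qed
qed


section \<open>Functoriality of the pullback of forms\<close>

lemma complex_manifold_charts:
  assumes "complex_manifold X A"
  shows "topspace X = (\<Union>c\<in>A. fst c)"
    and "c \<in> A \<Longrightarrow> openin X (fst c)"
    and "c \<in> A \<Longrightarrow> p \<in> fst c \<Longrightarrow> chart_inv c (snd c p) = p"
proof -
  show top: "topspace X = (\<Union>c\<in>A. fst c)" using assms by (simp add: complex_manifold_def)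
  show "openin X (fst c)" if "c \<in> A"
    using assms that by (simp add: complex_manifold_def)
  show "chart_inv c (snd c p) = p" if c: "c \<in> A" and p: "p \<in> fst c"
  proof -
    have "homeomorphic_map (subtopology X (fst c)) (top_of_set (snd c ` fst c)) (snd c)"
      using assms c by (simp add: complex_manifold_def)
    then have "inj_on (snd c) (topspace (subtopology X (fst c)))"
      by (rule homeomorphic_imp_injective_map)
    moreover have "topspace (subtopology X (fst c)) = fst c" using c top by auto
    ultimately show ?thesis using p by (simp add: inv_into_f_f)
  qed
qed

text \<open>
  Derivatives are unchanged if a function is modified outside an open set; openness of the domain
  of a coordinate representation is what allows computing the derivative of a composition from the
  representations of the factors.
\<close>

lemma open_local_rep_dom:
  assumes M: "complex_manifold X A" and c: "c \<in> A" and d: "d \<in> A" and g: "continuous_map X X g"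
  shows "open (local_rep_dom c d g)"
proof -
  have hom: "homeomorphic_map (subtopology X (fst c)) (top_of_set (snd c ` fst c)) (snd c)"
    and op: "open (snd c ` fst c)"
    using M c by (simp_all add: complex_manifold_def)
  have sub: "fst c \<subseteq> topspace X" using complex_manifold_charts(2)[OF M c] by (rule openin_subset)
  have "openin X {p \<in> topspace X. g p \<in> fst d}"
    using g complex_manifold_charts(2)[OF M d] by (rule openin_continuous_map_preimage)
  then have "openin (subtopology X (fst c)) ({p \<in> topspace X. g p \<in> fst d} \<inter> fst c)"
    by (rule openin_subtopology_Int)
  also have "{p \<in> topspace X. g p \<in> fst d} \<inter> fst c = {p \<in> fst c. g p \<in> fst d}"
    using sub by auto
  finally have "openin (top_of_set (snd c ` fst c)) (local_rep_dom c d g)"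
    using hom homeomorphic_map_openness_eq unfolding local_rep_dom_def by blast
  then show ?thesis using op openin_open_trans by blast
qed

text \<open>
  The chain rule treats holomorphic and anti-holomorphic maps alike, so only the real
  differentiability common to both is retained.
\<close>

definition differentiable_map :: "'a topology \<Rightarrow> ('a, 'n::finite) chart set \<Rightarrow> ('a \<Rightarrow> 'a) \<Rightarrow> bool" where
  "differentiable_map X A g \<longleftrightarrow> continuous_map X X g \<and>
     (\<forall>c\<in>A. \<forall>d\<in>A. \<forall>z\<in>local_rep_dom c d g. local_rep c d g differentiable (at z))"

lemma holomorphic_imp_differentiable_map: "holomorphic_map X A g \<Longrightarrow> differentiable_map X A g"
  unfolding holomorphic_map_def differentiable_map_def holomorphic_vec_on_def
  by (blast intro: differentiableI)

lemma antiholomorphic_imp_differentiable_map: "antiholomorphic_map X A g \<Longrightarrow> differentiable_map X A g"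
  unfolding antiholomorphic_map_def differentiable_map_def antiholomorphic_vec_on_def
  by (blast intro: differentiableI)

lemma differentiable_map_id: "complex_manifold X A \<Longrightarrow> differentiable_map X A id"
  unfolding complex_manifold_def differentiable_map_def holomorphic_vec_on_def
  by (simp add: continuous_map_id) (blast intro: differentiableI)

text \<open>
  The chain rule in charts.  The composite \<open>k\<close> is only required to agree with \<open>g \<circ> h\<close> on the
  manifold, because group actions by extensional maps are multiplicative only there.
\<close>

lemma frechet_derivative_local_rep_comp:
  assumes M: "complex_manifold X A" and g: "differentiable_map X A g" and h: "differentiable_map X A h"
    and comp: "\<And>q. q \<in> topspace X \<Longrightarrow> k q = g (h q)"
    and c: "c \<in> A" and d: "d \<in> A" and e: "e \<in> A"
    and p: "p \<in> fst c" "h p \<in> fst d" "g (h p) \<in> fst e"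
  shows "frechet_derivative (local_rep c e k) (at (snd c p)) v =
    frechet_derivative (local_rep d e g) (at (snd d (h p)))
      (frechet_derivative (local_rep c d h) (at (snd c p)) v)"
proof -
  have hp: "local_rep c d h (snd c p) = snd d (h p)"
    using complex_manifold_charts(3)[OF M c p(1)] by (simp add: local_rep_def)
  have dom_h: "snd c p \<in> local_rep_dom c d h" and dom_g: "snd d (h p) \<in> local_rep_dom d e g"
    using p by (auto simp: local_rep_dom_def)
  have dh: "local_rep c d h differentiable (at (snd c p))"
    using h c d dom_h by (simp add: differentiable_map_def)
  have dg: "local_rep d e g differentiable (at (local_rep c d h (snd c p)))"
    using g d e dom_g by (simp add: differentiable_map_def hp)
  have "local_rep d e g (local_rep c d h z) = local_rep c e k z" if z: "z \<in> local_rep_dom c d h" for z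
  proof -
    obtain q where q: "q \<in> fst c" "h q \<in> fst d" "z = snd c q"
      using z by (auto simp: local_rep_dom_def)
    then have "q \<in> topspace X" using complex_manifold_charts(1)[OF M] c by auto
    then show ?thesis
      using q complex_manifold_charts(3)[OF M] c d by (simp add: local_rep_def comp)
  qed
  then have "frechet_derivative (local_rep d e g \<circ> local_rep c d h) (at (snd c p))
      = frechet_derivative (local_rep c e k) (at (snd c p))"
    using open_local_rep_dom[OF M c d] h dom_h dh dg
    by (intro frechet_derivative_transform_within_open[where X = "local_rep_dom c d h"])
       (auto simp: differentiable_map_def intro: differentiable_chain_at)
  then show ?thesis
    using frechet_derivative_compose[OF dh dg] by (simp add: hp fun_eq_iff)
qed

text \<open>
  The chain rule for \<open>g = g \<circ> id\<close>: a change of the source chart acts on the coordinates of the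
  tangent vector and on the derivative of \<open>g\<close> in opposite ways, so the chart chosen in the definition
  of the pushforward is immaterial.
\<close>

lemma pushforward_in_charts:
  assumes M: "complex_manifold X A" and g: "differentiable_map X A g"
    and v: "v \<in> tangent_space A p" and c: "c \<in> A" "p \<in> fst c" and d: "d \<in> A" "g p \<in> fst d"
  shows "pushforward A g p v d = frechet_derivative (local_rep c d g) (at (snd c p)) (v c)"
proof -
  define c0 where "c0 = (SOME c. c \<in> A \<and> p \<in> fst c)"
  have c0: "c0 \<in> A" "p \<in> fst c0"
    using someI[of "\<lambda>c. c \<in> A \<and> p \<in> fst c" c] c by (auto simp: c0_def)
  have vc: "v c = frechet_derivative (local_rep c0 c id) (at (snd c0 p)) (v c0)"
    using v c c0 unfolding tangent_space_def by blast
  have "frechet_derivative (local_rep c0 d g) (at (snd c0 p)) (v c0)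
      = frechet_derivative (local_rep c d g) (at (snd c p)) (v c)"
    using frechet_derivative_local_rep_comp[OF M g differentiable_map_id[OF M], of g c0 c d p] c0 c d
    by (simp add: vc)
  then show ?thesis using d by (simp add: pushforward_def Let_def flip: c0_def)
qed

text \<open>
  The chain rule for \<open>g = id \<circ> g\<close>, now with a change of the target chart.
\<close>

lemma pushforward_tangent:
  assumes M: "complex_manifold X A" and g: "differentiable_map X A g"
    and p: "p \<in> topspace X" and v: "v \<in> tangent_space A p"
  shows "pushforward A g p v \<in> tangent_space A (g p)"
proof -
  obtain c where c: "c \<in> A" "p \<in> fst c" using p complex_manifold_charts(1)[OF M] by auto
  have "pushforward A g p v e
      = frechet_derivative (local_rep d e id) (at (snd d (g p))) (pushforward A g p v d)"
    if "d \<in> A" "e \<in> A" "g p \<in> fst d" "g p \<in> fst e" for d e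
    using that pushforward_in_charts[OF M g v c]
      frechet_derivative_local_rep_comp[OF M differentiable_map_id[OF M] g, of g c d e p] c
    by simp
  moreover have "pushforward A g p v d = 0" if "d \<notin> A \<or> g p \<notin> fst d" for d
    using that by (auto simp: pushforward_def Let_def)
  ultimately show ?thesis unfolding tangent_space_def mem_Collect_eq by blast
qed

lemma pushforward_comp:
  assumes M: "complex_manifold X A" and g: "differentiable_map X A g" and h: "differentiable_map X A h"
    and k: "differentiable_map X A k" and comp: "\<And>q. q \<in> topspace X \<Longrightarrow> k q = g (h q)"
    and p: "p \<in> topspace X" and v: "v \<in> tangent_space A p"
  shows "pushforward A k p v = pushforward A g (h p) (pushforward A h p v)"
proof
  fix e
  show "pushforward A k p v e = pushforward A g (h p) (pushforward A h p v) e"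
  proof (cases "e \<in> A \<and> k p \<in> fst e")
    case True
    have hp: "h p \<in> topspace X"
      using h p by (auto simp: differentiable_map_def continuous_map_def)
    obtain c d where c: "c \<in> A" "p \<in> fst c" and d: "d \<in> A" "h p \<in> fst d"
      using p hp complex_manifold_charts(1)[OF M] by auto
    show ?thesis
      using True comp[OF p] c d
        pushforward_in_charts[OF M k v c] pushforward_in_charts[OF M h v c d]
        pushforward_in_charts[OF M g pushforward_tangent[OF M h p v] d]
        frechet_derivative_local_rep_comp[OF M g h comp c(1) d(1) _ c(2) d(2)]
      by simp
  next
    case False
    then show ?thesis using comp[OF p] by (auto simp: pushforward_def Let_def)
  qed
qed


section \<open>The phases form a cocycle\<close>

lemma graded_group_parity:
  assumes "graded_group G \<epsilon>"
  shows "\<gamma> \<in> carrier G \<Longrightarrow> \<epsilon> \<gamma> = 0 \<or> \<epsilon> \<gamma> = 1"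
    and "\<gamma> \<in> carrier G \<Longrightarrow> \<eta> \<in> carrier G \<Longrightarrow> \<epsilon> (\<gamma> \<otimes>\<^bsub>G\<^esub> \<eta>) = (\<epsilon> \<gamma> + \<epsilon> \<eta>) mod 2"
    and "\<epsilon> \<one>\<^bsub>G\<^esub> = 0"
proof -
  interpret group G using assms by (simp add: graded_group_def)
  have hom: "\<epsilon> \<in> hom G (integer_mod_group 2)" using assms by (simp add: graded_group_def epi_def)
  show par: "\<epsilon> \<gamma> = 0 \<or> \<epsilon> \<gamma> = 1" if "\<gamma> \<in> carrier G" for \<gamma>
    using hom_carrier[OF hom] that by (force simp: carrier_integer_mod_group)
  show mult: "\<epsilon> (\<gamma> \<otimes>\<^bsub>G\<^esub> \<eta>) = (\<epsilon> \<gamma> + \<epsilon> \<eta>) mod 2" if "\<gamma> \<in> carrier G" "\<eta> \<in> carrier G" for \<gamma> \<eta>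
    using hom_mult[OF hom that] by simp
  show "\<epsilon> \<one>\<^bsub>G\<^esub> = 0" using mult[of "\<one>\<^bsub>G\<^esub>" "\<one>\<^bsub>G\<^esub>"] par[of "\<one>\<^bsub>G\<^esub>"] by auto
qed

lemma group_module_sgn_act:
  fixes \<epsilon> :: "'g \<Rightarrow> int"
  assumes "graded_group G \<epsilon>"
  shows "group_module G (sgn_act \<epsilon> :: 'g \<Rightarrow> 'm::ab_group_add \<Rightarrow> 'm)"
proof -
  interpret group G using assms by (simp add: graded_group_def)
  show ?thesis
  proof
    fix \<gamma> \<eta> :: 'g and x y :: 'm
    show "sgn_act \<epsilon> \<gamma> (x + y) = sgn_act \<epsilon> \<gamma> x + sgn_act \<epsilon> \<gamma> y" by (simp add: sgn_act_def)
    show "sgn_act \<epsilon> \<one>\<^bsub>G\<^esub> x = x" using graded_group_parity(3)[OF assms] by (simp add: sgn_act_def)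
    assume "\<gamma> \<in> carrier G" "\<eta> \<in> carrier G"
    then show "sgn_act \<epsilon> (\<gamma> \<otimes>\<^bsub>G\<^esub> \<eta>) x = sgn_act \<epsilon> \<gamma> (sgn_act \<epsilon> \<eta> x)"
      using graded_group_parity(1,2)[OF assms, of \<gamma>] graded_group_parity(1)[OF assms, of \<eta>]
      by (auto simp: sgn_act_def)
  qed
qed

text \<open>
  The multiplicative counterpart of \<^const>\<open>sgn_act\<close>: the two actions correspond under \<^const>\<open>rz_exp\<close>.
  It treats even and odd elements uniformly.
\<close>

definition cnj_act :: "('g \<Rightarrow> int) \<Rightarrow> 'g \<Rightarrow> complex \<Rightarrow> complex" where
  "cnj_act \<epsilon> \<gamma> w = (if \<epsilon> \<gamma> = 0 then w else cnj w)"

lemma cnj_act_mult: "cnj_act \<epsilon> \<gamma> (w * w') = cnj_act \<epsilon> \<gamma> w * cnj_act \<epsilon> \<gamma> w'"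
  by (simp add: cnj_act_def)

lemma cnj_act_rz_exp: "cnj_act \<epsilon> \<gamma> (rz_exp r) = rz_exp (sgn_act \<epsilon> \<gamma> r)"
  by (simp add: cnj_act_def sgn_act_def cnj_rz_exp)

lemma phase_cocycle_eval:
  assumes "graded_group G \<epsilon>"
  shows "phase_cocycle A G \<epsilon> \<rho> \<Omega> a \<longleftrightarrow> a \<in> extensional (carrier G) \<and>
    (\<forall>\<gamma>\<in>carrier G. \<forall>p\<in>(\<Union>c\<in>A. fst c). \<forall>v. (\<forall>i. v i \<in> tangent_space A p) \<longrightarrow>
      \<Omega> (\<rho> \<gamma> p) (\<lambda>i. pushforward A (\<rho> \<gamma>) p (v i)) = rz_exp (a \<gamma>) * cnj_act \<epsilon> \<gamma> (\<Omega> p v))"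
proof -
  have "(\<epsilon> \<gamma> = 0 \<longrightarrow> form_eq A (pullback A (\<rho> \<gamma>) \<Omega>) (form_scale (rz_exp (a \<gamma>)) \<Omega>)) \<and>
        (\<epsilon> \<gamma> = 1 \<longrightarrow> form_eq A (pullback A (\<rho> \<gamma>) \<Omega>) (form_scale (rz_exp (a \<gamma>)) (form_cnj \<Omega>)))
    \<longleftrightarrow> (\<forall>p\<in>(\<Union>c\<in>A. fst c). \<forall>v. (\<forall>i. v i \<in> tangent_space A p) \<longrightarrow>
      \<Omega> (\<rho> \<gamma> p) (\<lambda>i. pushforward A (\<rho> \<gamma>) p (v i)) = rz_exp (a \<gamma>) * cnj_act \<epsilon> \<gamma> (\<Omega> p v))"
    if "\<gamma> \<in> carrier G" for \<gamma>
    using graded_group_parity(1)[OF assms that]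
    by (auto simp: form_eq_def pullback_def form_scale_def form_cnj_def cnj_act_def)
  then show ?thesis unfolding phase_cocycle_def by blast
qed

lemma nonzero_value_of_volume_form:
  assumes "calabi_yau X A \<Omega>"
  obtains p v where "p \<in> topspace X" "\<And>i. v i \<in> tangent_space A p" "\<Omega> p v \<noteq> 0"
proof -
  have M: "complex_manifold X A" and "topspace X \<noteq> {}" and "nowhere_vanishing A \<Omega>"
    using assms by (simp_all add: calabi_yau_def)
  then show ?thesis
    using that unfolding nowhere_vanishing_def complex_manifold_charts(1)[OF M] by blast
qed

text \<open>
  Both ways of pulling back \<open>\<Omega>\<close> along \<open>\<gamma> \<delta>\<close> are evaluated on a tuple \<open>v\<close> with \<open>\<Omega> p v \<noteq> 0\<close>: directly, and
  first along \<open>\<gamma>\<close> at the point \<open>\<delta> p\<close>, then along \<open>\<delta>\<close>.  The second way conjugates the phase of \<open>\<delta>\<close> if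
  \<open>\<gamma>\<close> is odd, which is where the sign in the cocycle identity comes from.
\<close>

lemma phase_cocycle_mult:
  assumes CY: "calabi_yau X A \<Omega>" and G: "graded_group G \<epsilon>"
    and act: "graded_holomorphic_action X A G \<epsilon> \<rho>" and ph: "phase_cocycle A G \<epsilon> \<rho> \<Omega> a"
    and \<gamma>: "\<gamma> \<in> carrier G" and \<delta>: "\<delta> \<in> carrier G"
  shows "a (\<gamma> \<otimes>\<^bsub>G\<^esub> \<delta>) = a \<gamma> + sgn_act \<epsilon> \<gamma> (a \<delta>)"
proof -
  interpret group G using G by (simp add: graded_group_def)
  interpret \<rho>: group_action G "topspace X" \<rho>
    using act by (simp add: graded_holomorphic_action_def)
  have M: "complex_manifold X A" using CY by (simp add: calabi_yau_def)
  have diff: "differentiable_map X A (\<rho> \<eta>)" if "\<eta> \<in> carrier G" for \<eta>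
    using act that graded_group_parity(1)[OF G that]
    by (auto simp: graded_holomorphic_action_def
        intro: holomorphic_imp_differentiable_map antiholomorphic_imp_differentiable_map)
  obtain p v where p: "p \<in> topspace X" and v: "\<And>i. v i \<in> tangent_space A p" and nz: "\<Omega> p v \<noteq> 0"
    using nonzero_value_of_volume_form[OF CY] by blast
  have eval: "\<Omega> (\<rho> \<eta> q) (\<lambda>i. pushforward A (\<rho> \<eta>) q (w i)) = rz_exp (a \<eta>) * cnj_act \<epsilon> \<eta> (\<Omega> q w)"
    if "\<eta> \<in> carrier G" "q \<in> topspace X" "\<And>i. w i \<in> tangent_space A q" for \<eta> q w
    using ph that unfolding phase_cocycle_eval[OF G] complex_manifold_charts(1)[OF M] by blast
  let ?w = "\<lambda>i. pushforward A (\<rho> \<delta>) p (v i)"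
  have comp: "\<rho> (\<gamma> \<otimes>\<^bsub>G\<^esub> \<delta>) q = \<rho> \<gamma> (\<rho> \<delta> q)" if "q \<in> topspace X" for q
    using \<rho>.composition_rule[OF that \<gamma> \<delta>] .
  have "rz_exp (a (\<gamma> \<otimes>\<^bsub>G\<^esub> \<delta>)) * cnj_act \<epsilon> (\<gamma> \<otimes>\<^bsub>G\<^esub> \<delta>) (\<Omega> p v)
      = \<Omega> (\<rho> (\<gamma> \<otimes>\<^bsub>G\<^esub> \<delta>) p) (\<lambda>i. pushforward A (\<rho> (\<gamma> \<otimes>\<^bsub>G\<^esub> \<delta>)) p (v i))"
    using \<gamma> \<delta> p v by (simp add: eval)
  also have "\<dots> = \<Omega> (\<rho> \<gamma> (\<rho> \<delta> p)) (\<lambda>i. pushforward A (\<rho> \<gamma>) (\<rho> \<delta> p) (?w i))"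
    using pushforward_comp[OF M diff[OF \<gamma>] diff[OF \<delta>] diff comp p v] \<gamma> \<delta> p by (simp add: comp)
  also have "\<dots> = rz_exp (a \<gamma>) * cnj_act \<epsilon> \<gamma> (\<Omega> (\<rho> \<delta> p) ?w)"
    using \<rho>.element_image[OF \<delta> p] pushforward_tangent[OF M diff[OF \<delta>] p v]
    by (intro eval[OF \<gamma>]) simp_all
  also have "\<dots> = rz_exp (a \<gamma>) * cnj_act \<epsilon> \<gamma> (rz_exp (a \<delta>) * cnj_act \<epsilon> \<delta> (\<Omega> p v))"
    using \<delta> p v by (simp add: eval)
  also have "\<dots> = rz_exp (a \<gamma> + sgn_act \<epsilon> \<gamma> (a \<delta>)) * cnj_act \<epsilon> \<gamma> (cnj_act \<epsilon> \<delta> (\<Omega> p v))"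
    by (simp add: cnj_act_mult cnj_act_rz_exp rz_exp_add)
  also have "cnj_act \<epsilon> \<gamma> (cnj_act \<epsilon> \<delta> (\<Omega> p v)) = cnj_act \<epsilon> (\<gamma> \<otimes>\<^bsub>G\<^esub> \<delta>) (\<Omega> p v)"
    using graded_group_parity(1,2)[OF G, of \<gamma>] graded_group_parity(1)[OF G, of \<delta>] \<gamma> \<delta>
    by (auto simp: cnj_act_def)
  finally have "rz_exp (a (\<gamma> \<otimes>\<^bsub>G\<^esub> \<delta>)) = rz_exp (a \<gamma> + sgn_act \<epsilon> \<gamma> (a \<delta>))"
    using nz by (simp add: cnj_act_def split: if_splits)
  then show ?thesis by (simp add: inj_rz_exp)
qed

text \<open>
  Pulling back the constant \<open>k\<close> does not change it, whereas the target form contains \<open>cnj k\<close> for odd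
  elements; comparing coefficients at a point where \<open>\<Omega>\<close> does not vanish leaves a condition on numbers.
\<close>

lemma real_normalized_scale_iff:
  assumes CY: "calabi_yau X A \<Omega>" and G: "graded_group G \<epsilon>" and ph: "phase_cocycle A G \<epsilon> \<rho> \<Omega> a"
  shows "real_normalized A G \<epsilon> \<rho> (form_scale k \<Omega>) \<longleftrightarrow>
    (\<forall>\<gamma>\<in>carrier G. k * rz_exp (a \<gamma>) = cnj_act \<epsilon> \<gamma> k)"
proof -
  have M: "complex_manifold X A" using CY by (simp add: calabi_yau_def)
  have *: "(\<epsilon> \<gamma> = 0 \<longrightarrow> form_eq A (pullback A (\<rho> \<gamma>) (form_scale k \<Omega>)) (form_scale k \<Omega>)) \<and>
      (\<epsilon> \<gamma> = 1 \<longrightarrow> form_eq A (pullback A (\<rho> \<gamma>) (form_scale k \<Omega>)) (form_cnj (form_scale k \<Omega>)))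
    \<longleftrightarrow> k * rz_exp (a \<gamma>) = cnj_act \<epsilon> \<gamma> k" (is "?N \<longleftrightarrow> ?k") if \<gamma>: "\<gamma> \<in> carrier G" for \<gamma>
  proof -
    have eval: "\<Omega> (\<rho> \<gamma> q) (\<lambda>i. pushforward A (\<rho> \<gamma>) q (w i)) = rz_exp (a \<gamma>) * cnj_act \<epsilon> \<gamma> (\<Omega> q w)"
      if "q \<in> topspace X" "\<And>i. w i \<in> tangent_space A q" for q w
      using ph \<gamma> that unfolding phase_cocycle_eval[OF G] complex_manifold_charts(1)[OF M] by blast
    have "?N \<longleftrightarrow> (\<forall>p\<in>topspace X. \<forall>v. (\<forall>i. v i \<in> tangent_space A p) \<longrightarrow>
        k * \<Omega> (\<rho> \<gamma> p) (\<lambda>i. pushforward A (\<rho> \<gamma>) p (v i)) = cnj_act \<epsilon> \<gamma> (k * \<Omega> p v))"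
      using graded_group_parity(1)[OF G \<gamma>]
      unfolding form_eq_def pullback_def form_scale_def form_cnj_def complex_manifold_charts(1)[OF M]
      by (elim disjE) (simp_all add: cnj_act_def)
    also have "\<dots> \<longleftrightarrow> (\<forall>p\<in>topspace X. \<forall>v. (\<forall>i. v i \<in> tangent_space A p) \<longrightarrow>
        k * rz_exp (a \<gamma>) * cnj_act \<epsilon> \<gamma> (\<Omega> p v) = cnj_act \<epsilon> \<gamma> k * cnj_act \<epsilon> \<gamma> (\<Omega> p v))"
      by (intro ball_cong all_cong refl) (simp add: eval cnj_act_mult mult.assoc)
    also have "\<dots> \<longleftrightarrow> ?k"
    proof
      assume L: "\<forall>p\<in>topspace X. \<forall>v. (\<forall>i. v i \<in> tangent_space A p) \<longrightarrow>
        k * rz_exp (a \<gamma>) * cnj_act \<epsilon> \<gamma> (\<Omega> p v) = cnj_act \<epsilon> \<gamma> k * cnj_act \<epsilon> \<gamma> (\<Omega> p v)"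
      obtain p v where "p \<in> topspace X" "\<And>i. v i \<in> tangent_space A p" and nz: "\<Omega> p v \<noteq> 0"
        using nonzero_value_of_volume_form[OF CY] by blast
      then have "k * rz_exp (a \<gamma>) * cnj_act \<epsilon> \<gamma> (\<Omega> p v) = cnj_act \<epsilon> \<gamma> k * cnj_act \<epsilon> \<gamma> (\<Omega> p v)"
        using L by blast
      then show ?k using nz by (simp add: cnj_act_def split: if_splits)
    qed simp
    finally show ?thesis .
  qed
  show ?thesis unfolding real_normalized_def using * by (intro ball_cong refl)
qed


section \<open>Coherent lifts\<close>

lemma coherent_lifts_eq:
  "coherent_lifts G \<epsilon> a = {b. real_lift G a b \<and> b \<in> carrier (Z1 G (sgn_act \<epsilon>))}"
  by (auto simp: coherent_lifts_def real_lift_def mem_Z1)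

text \<open>
  Averaging: summing \<open>b (\<gamma> \<delta>) = b \<gamma> + \<epsilon>(\<gamma>) b \<delta>\<close> over all \<open>\<delta>\<close> gives \<open>S = n b \<gamma> + \<epsilon>(\<gamma>) S\<close>, where \<open>n\<close> is the
  order of the group and \<open>S\<close> the sum of all values of \<open>b\<close>, so that \<open>t = - S / n\<close> works.
\<close>

lemma twisted_real_cocycle_is_coboundary:
  fixes b :: "'g \<Rightarrow> real"
  assumes G: "graded_group G \<epsilon>" and b: "b \<in> carrier (Z1 G (sgn_act \<epsilon>))"
  obtains t where "\<And>\<gamma>. \<gamma> \<in> carrier G \<Longrightarrow> b \<gamma> = d0 (sgn_act \<epsilon>) t \<gamma>"
proof
  interpret group G using G by (simp add: graded_group_def)
  have fin: "finite (carrier G)" using G by (simp add: graded_group_def)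
  define n where "n = real (card (carrier G))"
  define S where "S = (\<Sum>\<delta>\<in>carrier G. b \<delta>)"
  have n: "n \<noteq> 0" using fin one_closed by (auto simp: n_def)
  fix \<gamma> assume \<gamma>: "\<gamma> \<in> carrier G"
  have "S = (\<Sum>\<delta>\<in>carrier G. b (\<gamma> \<otimes>\<^bsub>G\<^esub> \<delta>))"
    unfolding S_def
    by (rule sum.reindex_bij_betw[symmetric], rule bij_betwI[where g = "\<lambda>\<delta>. inv\<^bsub>G\<^esub> \<gamma> \<otimes>\<^bsub>G\<^esub> \<delta>"])
       (use \<gamma> in \<open>auto simp: m_assoc[symmetric]\<close>)
  also have "\<dots> = (\<Sum>\<delta>\<in>carrier G. b \<gamma> + sgn_act \<epsilon> \<gamma> (b \<delta>))"
    using b \<gamma> by (intro sum.cong) (auto simp: mem_Z1)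
  also have "\<dots> = n * b \<gamma> + sgn_act \<epsilon> \<gamma> S"
    by (simp add: sum.distrib n_def S_def sgn_act_def sum_negf)
  finally show "b \<gamma> = d0 (sgn_act \<epsilon>) (- S / n) \<gamma>"
    using n by (cases "\<epsilon> \<gamma> = 0") (simp_all add: d0_def sgn_act_def field_simps)
qed

text \<open>
  For \<open>k = e\<^sup>2\<^sup>\<pi>\<^sup>i\<^sup>t\<close> the condition on \<open>k\<close> says that the coboundary of \<open>t\<close> lifts the phases.  Coboundaries
  are coherent, and by averaging all coherent lifts are coboundaries.
\<close>

lemma coherent_lift_iff_normalizable:
  fixes \<epsilon> :: "'g \<Rightarrow> int"
  assumes CY: "calabi_yau X A \<Omega>" and G: "graded_group G \<epsilon>" and ph: "phase_cocycle A G \<epsilon> \<rho> \<Omega> a"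
  shows "coherent_lifts G \<epsilon> a \<noteq> {} \<longleftrightarrow>
    (\<exists>k. cmod k = 1 \<and> real_normalized A G \<epsilon> \<rho> (form_scale k \<Omega>))"
proof -
  interpret R: group_module G "sgn_act \<epsilon> :: 'g \<Rightarrow> real \<Rightarrow> real" by (rule group_module_sgn_act[OF G])
  have key: "rz_exp (rz_of_real t) * rz_exp (a \<gamma>) = cnj_act \<epsilon> \<gamma> (rz_exp (rz_of_real t)) \<longleftrightarrow>
      rz_of_real (d0 (sgn_act \<epsilon>) t \<gamma>) = a \<gamma>" for t \<gamma>
    unfolding cnj_act_rz_exp rz_exp_add[symmetric] inj_rz_exp
    by (auto simp: d0_def sgn_act_def rz_of_real_diff rz_of_real_minus algebra_simps)
  show ?thesis
  proof
    assume "coherent_lifts G \<epsilon> a \<noteq> {}"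
    then obtain b where b: "real_lift G a b" "b \<in> carrier (Z1 G (sgn_act \<epsilon>))"
      by (auto simp: coherent_lifts_eq)
    obtain t where "\<And>\<gamma>. \<gamma> \<in> carrier G \<Longrightarrow> b \<gamma> = d0 (sgn_act \<epsilon>) t \<gamma>"
      using twisted_real_cocycle_is_coboundary[OF G b(2)] by blast
    then have "real_normalized A G \<epsilon> \<rho> (form_scale (rz_exp (rz_of_real t)) \<Omega>)"
      using b(1) by (auto simp: real_normalized_scale_iff[OF CY G ph] key real_lift_def)
    then show "\<exists>k. cmod k = 1 \<and> real_normalized A G \<epsilon> \<rho> (form_scale k \<Omega>)"
      by (intro exI[of _ "rz_exp (rz_of_real t)"]) (simp add: rz_exp_of_real)
  next
    assume "\<exists>k. cmod k = 1 \<and> real_normalized A G \<epsilon> \<rho> (form_scale k \<Omega>)"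
    then obtain t where t: "real_normalized A G \<epsilon> \<rho> (form_scale (rz_exp (rz_of_real t)) \<Omega>)"
      by (metis unit_complex_eq_rz_exp)
    have "restrict (d0 (sgn_act \<epsilon>) t) (carrier G) \<in> B1 G (sgn_act \<epsilon>)" by (auto simp: B1_def)
    then have "restrict (d0 (sgn_act \<epsilon>) t) (carrier G) \<in> carrier (Z1 G (sgn_act \<epsilon>))"
      using R.B1_normal by (meson normal_imp_subgroup subgroup.mem_carrier)
    then have "restrict (d0 (sgn_act \<epsilon>) t) (carrier G) \<in> coherent_lifts G \<epsilon> a"
      using t by (auto simp: real_normalized_scale_iff[OF CY G ph] key coherent_lifts_eq real_lift_def)
    then show "coherent_lifts G \<epsilon> a \<noteq> {}" by blast
  qed
qed

lemma of_int_sgn_act: "of_int (sgn_act \<epsilon> \<gamma> m) = (sgn_act \<epsilon> \<gamma> (of_int m) :: 'r::ring_1)"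
  by (simp add: sgn_act_def)

text \<open>
  The cocycle identity makes the argument of the floor integral, so the floor is exact.
\<close>

lemma of_int_mu_R:
  assumes a: "a \<in> carrier (Z1 G (sgn_act \<epsilon>))" and b: "real_lift G a b"
    and G: "graded_group G \<epsilon>" and x: "x \<in> carrier G \<times> carrier G"
  shows "real_of_int (mu_R G \<epsilon> b x) = - d1 G (sgn_act \<epsilon>) b x"
proof -
  interpret group G using G by (simp add: graded_group_def)
  obtain \<gamma> \<delta> where \<gamma>\<delta>: "x = (\<gamma>, \<delta>)" "\<gamma> \<in> carrier G" "\<delta> \<in> carrier G" using x by auto
  have lift: "rz_of_real (b \<eta>) = a \<eta>" if "\<eta> \<in> carrier G" for \<eta>
    using b that by (simp add: real_lift_def)
  have "rz_of_real (b (\<gamma> \<otimes>\<^bsub>G\<^esub> \<delta>) - b \<gamma> - sgn_act \<epsilon> \<gamma> (b \<delta>)) = 0"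
    using a \<gamma>\<delta> by (simp add: mem_Z1 lift rz_of_real_diff rz_of_real_minus sgn_act_def)
  then show ?thesis
    using \<gamma>\<delta> by (simp add: rz_of_real_eq_0_iff mu_R_def d1_def)
qed

text \<open>
  The cochain \<open>- \<mu>\<close> pulls the differential of the lift \<open>b\<close> back to the integers, as the construction of
  the connecting map asks for.
\<close>

lemma mu_class_eq_inv_bockstein:
  fixes \<epsilon> :: "'g \<Rightarrow> int"
  assumes G: "graded_group G \<epsilon>" and a: "a \<in> carrier (Z1 G (sgn_act \<epsilon>))" and b: "real_lift G a b"
  shows "mu_R G \<epsilon> b \<in> carrier (Z2 G (sgn_act \<epsilon>))"
    and "mu_class G \<epsilon> b = inv\<^bsub>H2 G (sgn_act \<epsilon>)\<^esub> bockstein G \<epsilon> (class1 G (sgn_act \<epsilon>) a)"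
proof -
  interpret I: group_module G "sgn_act \<epsilon> :: 'g \<Rightarrow> int \<Rightarrow> int" by (rule group_module_sgn_act[OF G])
  interpret R: group_module G "sgn_act \<epsilon> :: 'g \<Rightarrow> real \<Rightarrow> real" by (rule group_module_sgn_act[OF G])
  define z where "z = (\<lambda>x\<in>carrier G \<times> carrier G. - mu_R G \<epsilon> b x)"
  have b': "b \<in> carrier (C1 G)" and z': "z \<in> carrier (C2 G)"
    using b by (simp_all add: real_lift_def z_def carrier_C1 carrier_C2)
  have ex: "rz_of_real y = 0 \<longleftrightarrow> y \<in> range real_of_int" for y
    by (auto simp: rz_of_real_eq_0_iff elim: Ints_cases)
  have iz: "real_of_int (z x) = d1 G (sgn_act \<epsilon>) b x" if "x \<in> carrier G \<times> carrier G" for x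
    using of_int_mu_R[OF a b G that] that by (simp add: z_def)
  have inj: "inj real_of_int" and surj: "surj rz_of_real"
    using surj_rz_of_real by (auto simp: inj_def surj_def) metis
  have act: "rz_of_real (sgn_act \<epsilon> \<gamma> y) = sgn_act \<epsilon> \<gamma> (rz_of_real y)" for \<gamma> y
    by (simp add: sgn_act_def rz_of_real_minus)
  have ext: "a \<in> extensional (carrier G)" using a by (simp add: mem_Z1)
  have lift: "rz_of_real (b \<gamma>) = a \<gamma>" if "\<gamma> \<in> carrier G" for \<gamma>
    using b that by (simp add: real_lift_def)
  note conn = connecting_class1[OF I.group_module_axioms R.group_module_axioms of_int_add inj of_int_sgn_act
      rz_of_real_add surj act ex b' z' ext lift iz]
  have Z: "z \<in> carrier (Z2 G (sgn_act \<epsilon>))" by (rule conn(1))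
  have bock: "bockstein G \<epsilon> (class1 G (sgn_act \<epsilon>) a) = class2 G (sgn_act \<epsilon>) z"
    unfolding bockstein_def by (rule conn(2))
  have mu: "mu_R G \<epsilon> b = (\<lambda>x\<in>carrier G \<times> carrier G. - z x)"
    by (auto simp: z_def fun_eq_iff mu_R_def)
  show "mu_class G \<epsilon> b = inv\<^bsub>H2 G (sgn_act \<epsilon>)\<^esub> bockstein G \<epsilon> (class1 G (sgn_act \<epsilon>) a)"
    unfolding mu_class_def bock using I.class2_inv[OF Z] mu by simp
  show "mu_R G \<epsilon> b \<in> carrier (Z2 G (sgn_act \<epsilon>))"
    using Z by (auto simp: mu mem_Z2 d2_def I.act_minus algebra_simps)
qed

lemma real_lifts_differ_by_shift:
  assumes b: "real_lift G a b" and b': "real_lift G a b'"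
  obtains f :: "'g \<Rightarrow> int" where "b' = shift G f b"
proof -
  have "\<exists>m::int. b' \<gamma> = b \<gamma> + of_int m" if "\<gamma> \<in> carrier G" for \<gamma>
  proof -
    have "rz_of_real (b' \<gamma>) = rz_of_real (b \<gamma>)" using b b' that by (simp add: real_lift_def)
    then obtain m :: int where "b' \<gamma> - b \<gamma> = of_int m"
      unfolding rz_of_real_eq_iff by (rule Ints_cases)
    then show ?thesis by (metis add.commute diff_add_cancel)
  qed
  then obtain f :: "'g \<Rightarrow> int" where "\<And>\<gamma>. \<gamma> \<in> carrier G \<Longrightarrow> b' \<gamma> = b \<gamma> + of_int (f \<gamma>)"
    by metis
  then have "b' = shift G f b"
    using b' by (intro extensionalityI[of _ "carrier G"]) (auto simp: real_lift_def shift_def)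
  then show ?thesis using that by blast
qed

text \<open>
  Every lift is \<open>b + f\<close> for an integral cochain \<open>f\<close>, and its differential is that of \<open>f\<close> minus \<open>\<mu>\<close>.
  Thus the coherent lifts correspond to the cochains with differential \<open>\<mu>\<close>.
\<close>

lemma mu_class_trivial_iff:
  fixes \<epsilon> :: "'g \<Rightarrow> int"
  assumes G: "graded_group G \<epsilon>" and a: "a \<in> carrier (Z1 G (sgn_act \<epsilon>))" and b: "real_lift G a b"
  shows "mu_class G \<epsilon> b = \<one>\<^bsub>H2 G (sgn_act \<epsilon>)\<^esub> \<longleftrightarrow> coherent_lifts G \<epsilon> a \<noteq> {}"
proof -
  interpret I: group_module G "sgn_act \<epsilon> :: 'g \<Rightarrow> int \<Rightarrow> int" by (rule group_module_sgn_act[OF G])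
  interpret R: group_module G "sgn_act \<epsilon> :: 'g \<Rightarrow> real \<Rightarrow> real" by (rule group_module_sgn_act[OF G])
  have d1_shift: "d1 G (sgn_act \<epsilon>) (shift G f b) (\<gamma>, \<delta>)
      = d1 G (sgn_act \<epsilon>) b (\<gamma>, \<delta>) + of_int (d1 G (sgn_act \<epsilon>) f (\<gamma>, \<delta>))"
    if "\<gamma> \<in> carrier G" "\<delta> \<in> carrier G" for f \<gamma> \<delta>
    using that by (simp add: d1_def shift_def of_int_sgn_act R.act_simps)
  have coh: "shift G f b \<in> coherent_lifts G \<epsilon> a \<longleftrightarrow>
      (\<forall>x\<in>carrier G \<times> carrier G. mu_R G \<epsilon> b x = d1 G (sgn_act \<epsilon>) f x)" for f
  proof -
    have "real_lift G a (shift G f b)"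
      using b by (auto simp: real_lift_def shift_def rz_of_real_add rz_of_real_eq_0_iff)
    then have "shift G f b \<in> coherent_lifts G \<epsilon> a \<longleftrightarrow>
        (\<forall>x\<in>carrier G \<times> carrier G. d1 G (sgn_act \<epsilon>) (shift G f b) x = 0)"
      by (simp add: coherent_lifts_eq Z1_def carrier_C1 real_lift_def)
    also have "\<dots> \<longleftrightarrow> (\<forall>x\<in>carrier G \<times> carrier G. real_of_int (mu_R G \<epsilon> b x) = of_int (d1 G (sgn_act \<epsilon>) f x))"
    proof (rule ball_cong[OF refl])
      fix x assume x: "x \<in> carrier G \<times> carrier G"
      have "d1 G (sgn_act \<epsilon>) (shift G f b) x
          = d1 G (sgn_act \<epsilon>) b x + of_int (d1 G (sgn_act \<epsilon>) f x)"
        using x d1_shift by (cases x) simp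
      then show "d1 G (sgn_act \<epsilon>) (shift G f b) x = 0 \<longleftrightarrow>
          real_of_int (mu_R G \<epsilon> b x) = of_int (d1 G (sgn_act \<epsilon>) f x)"
        using of_int_mu_R[OF a b G x] by auto
    qed
    finally show ?thesis by simp
  qed
  have "\<exists>f. b' = shift G f b" if "b' \<in> coherent_lifts G \<epsilon> a" for b'
  proof -
    have "real_lift G a b'" using that by (simp add: coherent_lifts_eq)
    then show ?thesis using real_lifts_differ_by_shift[OF b] by metis
  qed
  then have "coherent_lifts G \<epsilon> a \<noteq> {} \<longleftrightarrow> (\<exists>f. shift G f b \<in> coherent_lifts G \<epsilon> a)" by blast
  then show ?thesis
    unfolding mu_class_def I.class2_eq_one_iff[OF mu_class_eq_inv_bockstein(1)[OF G a b]] coh by simp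
qed

lemma coherent_lifts_torsor:
  fixes \<epsilon> :: "'g \<Rightarrow> int"
  assumes G: "graded_group G \<epsilon>" and ne: "coherent_lifts G \<epsilon> a \<noteq> {}"
  shows "torsor (Z1 G (sgn_act \<epsilon>)) (coherent_lifts G \<epsilon> a) (lift_action G \<epsilon> a)"
proof -
  interpret I: group_module G "sgn_act \<epsilon> :: 'g \<Rightarrow> int \<Rightarrow> int" by (rule group_module_sgn_act[OF G])
  interpret R: group_module G "sgn_act \<epsilon> :: 'g \<Rightarrow> real \<Rightarrow> real" by (rule group_module_sgn_act[OF G])
  interpret Z: comm_group "Z1 G (sgn_act \<epsilon> :: 'g \<Rightarrow> int \<Rightarrow> int)" by (rule I.comm_group_Z1)
  have closed: "shift G z b \<in> coherent_lifts G \<epsilon> a"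
    if z: "z \<in> carrier (Z1 G (sgn_act \<epsilon>))" and b: "b \<in> coherent_lifts G \<epsilon> a" for z b
  proof -
    have "rz_of_real (shift G z b \<gamma>) = a \<gamma>" if "\<gamma> \<in> carrier G" for \<gamma>
    proof -
      have "rz_of_real (b \<gamma>) = a \<gamma>" and "rz_of_real (real_of_int (z \<gamma>)) = 0"
        using b that by (auto simp: coherent_lifts_def real_lift_def rz_of_real_eq_0_iff)
      then show ?thesis using that by (simp add: shift_def rz_of_real_add)
    qed
    moreover have "shift G z b (\<gamma> \<otimes>\<^bsub>G\<^esub> \<delta>) = shift G z b \<gamma> + sgn_act \<epsilon> \<gamma> (shift G z b \<delta>)"
      if "\<gamma> \<in> carrier G" "\<delta> \<in> carrier G" for \<gamma> \<delta>
    proof -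
      have "z (\<gamma> \<otimes>\<^bsub>G\<^esub> \<delta>) = z \<gamma> + sgn_act \<epsilon> \<gamma> (z \<delta>)" using z that by (simp add: mem_Z1)
      moreover have "b (\<gamma> \<otimes>\<^bsub>G\<^esub> \<delta>) = b \<gamma> + sgn_act \<epsilon> \<gamma> (b \<delta>)"
        using b that by (simp add: coherent_lifts_def)
      ultimately show ?thesis
        using that by (simp add: shift_def of_int_sgn_act R.act_add)
    qed
    moreover have "shift G z b \<in> extensional (carrier G)" by (simp add: shift_def)
    ultimately show ?thesis by (simp add: coherent_lifts_def real_lift_def)
  qed
  have ext: "b \<in> extensional (carrier G)" if "b \<in> coherent_lifts G \<epsilon> a" for b
    using that by (simp add: coherent_lifts_eq real_lift_def)
  have "group_action (Z1 G (sgn_act \<epsilon>)) (coherent_lifts G \<epsilon> a) (lift_action G \<epsilon> a)"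
  proof (rule group_actionI)
    show "group (Z1 G (sgn_act \<epsilon> :: 'g \<Rightarrow> int \<Rightarrow> int))" by (rule Z.is_group)
    show "lift_action G \<epsilon> a z b \<in> coherent_lifts G \<epsilon> a"
      if "z \<in> carrier (Z1 G (sgn_act \<epsilon>))" "b \<in> coherent_lifts G \<epsilon> a" for z b
      using closed[OF that] that by (simp add: lift_action_def)
    show "lift_action G \<epsilon> a z \<in> extensional (coherent_lifts G \<epsilon> a)" for z
      by (simp add: lift_action_def)
    show "lift_action G \<epsilon> a \<one>\<^bsub>Z1 G (sgn_act \<epsilon>)\<^esub> b = b" if "b \<in> coherent_lifts G \<epsilon> a" for b
      using ext[OF that] that
      by (intro extensionalityI[of _ "carrier G"]) (auto simp: lift_action_def shift_def one_Z1)
    show "lift_action G \<epsilon> a (z \<otimes>\<^bsub>Z1 G (sgn_act \<epsilon>)\<^esub> z') b = lift_action G \<epsilon> a z (lift_action G \<epsilon> a z' b)"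
      if "z \<in> carrier (Z1 G (sgn_act \<epsilon>))" "z' \<in> carrier (Z1 G (sgn_act \<epsilon>))" "b \<in> coherent_lifts G \<epsilon> a"
      for z z' b
      using closed[OF that(2,3)] that(3)
      by (auto simp: lift_action_def shift_def mult_Z1 fun_eq_iff)
  qed
  moreover have "\<exists>!z. z \<in> carrier (Z1 G (sgn_act \<epsilon>)) \<and> lift_action G \<epsilon> a z b = b'"
    if b: "b \<in> coherent_lifts G \<epsilon> a" and b': "b' \<in> coherent_lifts G \<epsilon> a" for b b'
  proof -
    have "real_lift G a b" and "real_lift G a b'" using b b' by (simp_all add: coherent_lifts_eq)
    then obtain f :: "'g \<Rightarrow> int" where f: "b' = shift G f b"
      by (rule real_lifts_differ_by_shift)
    have shift_iff: "lift_action G \<epsilon> a z b = b' \<longleftrightarrow> (\<forall>\<gamma>\<in>carrier G. z \<gamma> = f \<gamma>)" for z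
      using b by (auto simp: f lift_action_def shift_def fun_eq_iff)
    have "restrict f (carrier G) \<in> carrier (Z1 G (sgn_act \<epsilon>))"
      unfolding mem_Z1
    proof (intro conjI ballI)
      fix \<gamma> \<eta> assume *: "\<gamma> \<in> carrier G" "\<eta> \<in> carrier G"
      have "b (\<gamma> \<otimes>\<^bsub>G\<^esub> \<eta>) = b \<gamma> + sgn_act \<epsilon> \<gamma> (b \<eta>)"
        and "b' (\<gamma> \<otimes>\<^bsub>G\<^esub> \<eta>) = b' \<gamma> + sgn_act \<epsilon> \<gamma> (b' \<eta>)"
        using * b b' by (simp_all add: coherent_lifts_def)
      then have "real_of_int (f (\<gamma> \<otimes>\<^bsub>G\<^esub> \<eta>)) = of_int (f \<gamma> + sgn_act \<epsilon> \<gamma> (f \<eta>))"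
        using * by (simp add: f shift_def of_int_sgn_act R.act_add)
      then show "restrict f (carrier G) (\<gamma> \<otimes>\<^bsub>G\<^esub> \<eta>)
          = restrict f (carrier G) \<gamma> + sgn_act \<epsilon> \<gamma> (restrict f (carrier G) \<eta>)"
        using * by simp
    qed simp
    moreover have "z = restrict f (carrier G)"
      if "z \<in> carrier (Z1 G (sgn_act \<epsilon>))" "\<forall>\<gamma>\<in>carrier G. z \<gamma> = f \<gamma>" for z
      using that by (intro extensionalityI[of _ "carrier G"]) (auto simp: mem_Z1)
    moreover have "\<forall>\<gamma>\<in>carrier G. restrict f (carrier G) \<gamma> = f \<gamma>" by simp
    ultimately show ?thesis unfolding shift_iff by blast
  qed
  ultimately show ?thesis unfolding torsor_def using ne by blast
qed

text \<open>
  Equivalence of lifts is the orbit relation of the coboundaries, so this is the quotient of the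
  preceding torsor.
\<close>

lemma coherent_lift_classes_torsor:
  fixes \<epsilon> :: "'g \<Rightarrow> int"
  assumes G: "graded_group G \<epsilon>" and ne: "coherent_lifts G \<epsilon> a \<noteq> {}"
  shows "torsor (H1 G (sgn_act \<epsilon>)) (coherent_lifts G \<epsilon> a // lift_equiv G \<epsilon> a) (lift_class_action G \<epsilon> a)"
proof -
  interpret I: group_module G "sgn_act \<epsilon> :: 'g \<Rightarrow> int \<Rightarrow> int" by (rule group_module_sgn_act[OF G])
  let ?E = "coherent_lifts G \<epsilon> a"
  have lift_ext: "b \<in> extensional (carrier G)" if "b \<in> ?E" for b
    using that by (simp add: coherent_lifts_eq real_lift_def)
  have shift_iff: "b' = lift_action G \<epsilon> a (restrict (d0 (sgn_act \<epsilon>) m) (carrier G)) b \<longleftrightarrow>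
      (\<forall>\<gamma>\<in>carrier G. b' \<gamma> - b \<gamma> = of_int (d0 (sgn_act \<epsilon>) m \<gamma>))" if "b \<in> ?E" "b' \<in> ?E" for b b' m
    using that lift_ext[OF that(2)]
    by (auto simp: lift_action_def shift_def algebra_simps intro!: extensionalityI[of _ "carrier G"])
  have equiv: "lift_equiv G \<epsilon> a
      = {(b, b'). b \<in> ?E \<and> b' \<in> ?E \<and> (\<exists>n\<in>B1 G (sgn_act \<epsilon>). b' = lift_action G \<epsilon> a n b)}"
    unfolding lift_equiv_def B1_def by (auto simp: shift_iff) (metis shift_iff)+
  have "lift_class_action G \<epsilon> a = (\<lambda>\<alpha>. \<lambda>B\<in>?E // lift_equiv G \<epsilon> a.
      {lift_action G \<epsilon> a z b |z b. z \<in> \<alpha> \<and> b \<in> B})"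
  proof
    fix \<alpha> :: "('g \<Rightarrow> int) set"
    have "{shift G z b |z b. z \<in> \<alpha> \<and> b \<in> B} = {lift_action G \<epsilon> a z b |z b. z \<in> \<alpha> \<and> b \<in> B}"
      if "B \<in> ?E // lift_equiv G \<epsilon> a" for B
    proof -
      have "B \<subseteq> ?E" using that by (auto simp: quotient_def lift_equiv_def)
      then have "lift_action G \<epsilon> a z b = shift G z b" if "b \<in> B" for z b
        using that by (auto simp: lift_action_def)
      then show ?thesis by (metis (no_types, opaque_lifting))
    qed
    then show "lift_class_action G \<epsilon> a \<alpha>
        = (\<lambda>B\<in>?E // lift_equiv G \<epsilon> a. {lift_action G \<epsilon> a z b |z b. z \<in> \<alpha> \<and> b \<in> B})"
      unfolding lift_class_action_def by (rule restrict_ext)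
  qed
  then show ?thesis
    unfolding H1_def
    using torsor_quotient[OF coherent_lifts_torsor[OF G ne] I.B1_normal equiv] by simp
qed

theorem theorem1p3:
  fixes X :: "'a topology"
    and A :: "('a, 'n::finite) chart set"
    and \<Omega> :: "('a, 'n) nform"
    and Ghat :: "('g, 'b) monoid_scheme"
    and \<epsilon> :: "'g \<Rightarrow> int"
    and \<rho> :: "'g \<Rightarrow> 'a \<Rightarrow> 'a"
    and a :: "'g \<Rightarrow> rz"
    and a_lift :: "'g \<Rightarrow> real"
  assumes "calabi_yau X A \<Omega>"
    and "graded_group Ghat \<epsilon>"
    and "graded_holomorphic_action X A Ghat \<epsilon> \<rho>"
    and "phase_cocycle A Ghat \<epsilon> \<rho> \<Omega> a"
    and "real_lift Ghat a a_lift"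
  shows "mu_class Ghat \<epsilon> a_lift =
           inv\<^bsub>H2 Ghat (sgn_act \<epsilon>)\<^esub> (bockstein Ghat \<epsilon> (class1 Ghat (sgn_act \<epsilon>) a))
       \<and> (mu_class Ghat \<epsilon> a_lift = \<one>\<^bsub>H2 Ghat (sgn_act \<epsilon>)\<^esub> \<longleftrightarrow> coherent_lifts Ghat \<epsilon> a \<noteq> {})
       \<and> (coherent_lifts Ghat \<epsilon> a \<noteq> {} \<longleftrightarrow>
            (\<exists>k. cmod k = 1 \<and> real_normalized A Ghat \<epsilon> \<rho> (form_scale k \<Omega>)))
       \<and> (mu_class Ghat \<epsilon> a_lift = \<one>\<^bsub>H2 Ghat (sgn_act \<epsilon>)\<^esub> \<longrightarrow>
            torsor (Z1 Ghat (sgn_act \<epsilon>)) (coherent_lifts Ghat \<epsilon> a) (lift_action Ghat \<epsilon> a) \<and>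
            torsor (H1 Ghat (sgn_act \<epsilon>)) (coherent_lifts Ghat \<epsilon> a // lift_equiv Ghat \<epsilon> a)
              (lift_class_action Ghat \<epsilon> a))"
proof -
  have "a \<in> carrier (Z1 Ghat (sgn_act \<epsilon>))"
    using phase_cocycle_mult[OF assms(1-4)] assms(4) by (simp add: mem_Z1 phase_cocycle_def)
  then show ?thesis
    using mu_class_eq_inv_bockstein(2)[OF assms(2) _ assms(5)] mu_class_trivial_iff[OF assms(2) _ assms(5)]
      coherent_lift_iff_normalizable[OF assms(1,2,4)]
      coherent_lifts_torsor[OF assms(2)] coherent_lift_classes_torsor[OF assms(2)]
    by blast
qed

end
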